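(* Let $\Pi = (t, \mathcal{P})$ be a local coloring problem and let $\mathsf{G} \subseteq \mathsf{FSG}$. Fix $n \in \mathbb{N}^+$ such that $\mathsf{Det}_{\Pi,\mathsf{G}}(n) < \infty$ and set $R := \mathsf{Det}_{\Pi,\mathsf{G}}(n) + t$. If $\boldsymbol{G}$ is a Borel structured graph that is $(R,n)$-locally in $\mathsf{G}$ and such that $|B_{\boldsymbol{G}}(x, 2R)| \leq n$ for all $x \in V(\boldsymbol{G})$, then $\boldsymbol{G}$ has a Borel $\Pi$-coloring.
   Context: Basic notation. $\mathbb{N}=\{0,1,2,\dots\}$, $\mathbb{N}^+=\mathbb{N}\setminus\{0\}$, $[m]=\{1,\dots,m\}$. Graphs are simple, undirected and locally finite (every vertex has finitely many neighbors). For a set $A$, $A^{<\infty}$ is the set of finite sequences of elements of $A$. $|G|$ denotes the number of vertices of $G$. Structured graphs. A structure map on a graph $G$ is a partial function $\sigma : V(G)^{<\infty} \rightharpoonup \mathbb{N}$ such that for some $\ell\in\mathbb{N}$ all tuples in $\mathrm{dom}(\sigma)$ have length at most $\ell$. A structured graph is a pair $\boldsymbol{G}=(G,\sigma)$ with $\sigma$ a structure map on $G$; $V(\boldsymbol{G})=V(G)$, distances, etc. refer to $G$. For $U\subseteq V(G)$, $\boldsymbol{G}[U]$ is the induced subgraph $G[U]$ together with the restriction of $\sigma$ to tuples from $U$. $B_{\boldsymbol{G}}(x,R)$ is $\boldsymbol{G}[\{y : \mathrm{dist}_G(x,y)\leq R\}]$. An isomorphism of structured graphs $(G_1,\sigma_1)$,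 $(G_2,\sigma_2)$ is a graph isomorphism $\phi$ that, applied coordinatewise to tuples, satisfies $\mathrm{dom}(\sigma_2)=\phi(\mathrm{dom}(\sigma_1))$ and $\sigma_1(\boldsymbol{x})=\sigma_2(\phi(\boldsymbol{x}))$. $[\boldsymbol{G}]$ is the isomorphism class of $\boldsymbol{G}$; $[\boldsymbol{G},x]$ is the isomorphism class of the rooted structured graph $(\boldsymbol{G},x)$, $x\in V(\boldsymbol G)$ (isomorphisms preserve roots). $\mathsf{FSG}$ (resp. $\mathsf{FSG}_\bullet$) is the countable set of isomorphism classes of finite structured graphs (resp. finite rooted structured graphs). If $\boldsymbol{G}=(G,\sigma)$ and $f: V(G)\rightharpoonup\mathbb{N}$, then $\boldsymbol{G}_f$ is the structured graph obtained by adding $f$ to the structure: its structure map sends $\boldsymbol{x}\in\mathrm{dom}(\sigma)\cup\mathrm{dom}(f)$ (vertices viewed as 1-tuples) to the code of $(\sigma(\boldsymbol{x}),f(\boldsymbol{x}))$ under a fixed injection $(\mathbb{N}\cup\{\ast\})^2\to\mathbb{N}$, where $\ast$ stands for "undefined". LOCAL algorithms and coloring problems. A LOCAL algorithm is a function $\mathcal{A}:\mathsf{FSG}_\bullet\to\mathbb{N}$; its output on $\boldsymbol{G}$ after $T\in\mathbb{N}$ rounds is $\mathcal{A}(\boldsymbol{G},T):V(\boldsymbol{G})\to\mathbb{N}$, $\mathcal{A}(\boldsymbol{G},T)(x)=\mathcal{A}([B_{\boldsymbol{G}}(x,T),x])$. A local coloring problem is a pair $\Pi=(t,\mathcal{P})$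 with $t\in\mathbb{N}$, $\mathcal{P}:\mathsf{FSG}_\bullet\to\{0,1\}$. A function $f:V(\boldsymbol{G})\to\mathbb{N}$ is a $\Pi$-coloring of $\boldsymbol{G}$ if $\mathcal{P}(\boldsymbol{G}_f,t)(x)=1$ for all $x\in V(\boldsymbol{G})$. Deterministic complexity. For $\mathsf{G}\subseteq\mathsf{FSG}$, $n\in\mathbb{N}^+$, $T\in\mathbb{N}$, write $\mathsf{Det}_{\Pi,\mathsf{G}}(n)\leq T$ if there is a LOCAL algorithm $\mathcal{A}$ such that for every $n$-vertex structured graph $\boldsymbol{H}$ with $[\boldsymbol{H}]\in\mathsf{G}$ and every bijection $\mathsf{id}:V(\boldsymbol{H})\to[n]$, the function $\mathcal{A}(\boldsymbol{H}_{\mathsf{id}},T)$ is a $\Pi$-coloring of $\boldsymbol{H}$. $\mathsf{Det}_{\Pi,\mathsf{G}}(n)$ is the least such $T$, or $\infty$ if there is none. Local membership. $\boldsymbol{G}$ is $(R,n)$-locally in $\mathsf{G}$ if for each $x\in V(\boldsymbol{G})$ there is an $n$-vertex structured graph $\boldsymbol{H}$ with $[\boldsymbol{H}]\in\mathsf{G}$ such that $[B_{\boldsymbol{G}}(x,R),x]=[B_{\boldsymbol{H}}(y,R),y]$ for some $y\in V(\boldsymbol{H})$. Borel notions. A Borel graph is a graph $G$ whose vertex set is a standard Borel space and whose adjacency relation is a Borel subset of $V(G)\times V(G)$. A Borel structured graph is $(G,\sigma)$ with $G$ a Borel graph and $\sigma$ Borel, i.e. $\sigma^{-1}(c)$ is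 Borel in $V(G)^{<\infty}=\bigsqcup_k V(G)^k$ for every $c\in\mathbb{N}$. A Borel $\Pi$-coloring is a $\Pi$-coloring $f:V(\boldsymbol{G})\to\mathbb{N}$ that is a Borel function. *)

theory Defs
  imports "HOL-Analysis.Analysis" "HOL-Library.Countable" "HOL-Library.Extended_Nat"
begin

section \<open>Structured graphs\<close>

text \<open>A finite tuple of vertices is a list, possibly empty. A structure map is a partial function
  on lists.\<close>

record 'a graph =
  verts :: "'a set"
  edges :: "('a \<times> 'a) set"

record 'a sgraph = "'a graph" +
  str_map :: "'a list \<Rightarrow> nat option"

definition lf_graph :: "('a, 'b) graph_scheme \<Rightarrow> bool" where
  "lf_graph G \<longleftrightarrow> edges G \<subseteq> verts G \<times> verts G \<and> sym (edges G) \<and> irrefl (edges G) \<and>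
     (\<forall>x\<in>verts G. finite {y. (x, y) \<in> edges G})"

definition structured_graph :: "'a sgraph \<Rightarrow> bool" where
  "structured_graph G \<longleftrightarrow> lf_graph G \<and> dom (str_map G) \<subseteq> lists (verts G) \<and>
     (\<exists>l. \<forall>xs\<in>dom (str_map G). length xs \<le> l)"

definition graph_dist :: "('a, 'b) graph_scheme \<Rightarrow> 'a \<Rightarrow> 'a \<Rightarrow> enat" where
  "graph_dist G x y = (INF k\<in>{k. (x, y) \<in> edges G ^^ k}. enat k)"

definition induced :: "'a sgraph \<Rightarrow> 'a set \<Rightarrow> 'a sgraph" where
  "induced G U = \<lparr>verts = verts G \<inter> U, edges = edges G \<inter> U \<times> U,
     str_map = str_map G |` lists U\<rparr>"

definition sball :: "'a sgraph \<Rightarrow> 'a \<Rightarrow> nat \<Rightarrow> 'a sgraph" where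
  "sball G x R = induced G {y \<in> verts G. graph_dist G x y \<le> enat R}"

definition sgraph_iso :: "('a \<Rightarrow> 'b) \<Rightarrow> 'a sgraph \<Rightarrow> 'b sgraph \<Rightarrow> bool" where
  "sgraph_iso \<phi> G H \<longleftrightarrow> bij_betw \<phi> (verts G) (verts H) \<and>
     (\<forall>x\<in>verts G. \<forall>y\<in>verts G. (x, y) \<in> edges G \<longleftrightarrow> (\<phi> x, \<phi> y) \<in> edges H) \<and>
     dom (str_map H) = map \<phi> ` dom (str_map G) \<and>
     (\<forall>xs\<in>dom (str_map G). str_map G xs = str_map H (map \<phi> xs))"


section \<open>Isomorphism classes\<close>

text \<open>Isomorphism classes are only ever needed for finite structured graphs, and every one of these
  has a copy whose vertices are natural numbers. The class of \<open>G\<close>, whatever its vertex type, is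
  therefore represented by the set of all its copies on natural numbers. For finite graphs, two
  classes are equal iff the graphs are isomorphic; this is proved in \<open>iso_class_eq_iff\<close> and
  \<open>rooted_class_eq_iff\<close> below.\<close>

type_synonym sgraph_class = "nat sgraph set"
type_synonym rooted_class = "(nat sgraph \<times> nat) set"

definition iso_class :: "'a sgraph \<Rightarrow> sgraph_class" where
  "iso_class G = {H. structured_graph H \<and> (\<exists>\<phi>. sgraph_iso \<phi> G H)}"

definition rooted_class :: "'a sgraph \<Rightarrow> 'a \<Rightarrow> rooted_class" where
  "rooted_class G x = {(H, y). structured_graph H \<and> (\<exists>\<phi>. sgraph_iso \<phi> G H \<and> \<phi> x = y)}"

definition FSG :: "sgraph_class set" where
  "FSG = {iso_class G | G :: nat sgraph. structured_graph G \<and> finite (verts G)}"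

definition FSG_rooted :: "rooted_class set" where
  "FSG_rooted = {rooted_class G x | (G :: nat sgraph) x.
     structured_graph G \<and> finite (verts G) \<and> x \<in> verts G}"

lemma sgraph_iso_id: "sgraph_iso id G G"
  by (simp add: sgraph_iso_def)

lemma sgraph_isoD:
  assumes "sgraph_iso \<phi> G H"
  shows "bij_betw \<phi> (verts G) (verts H)"
    and "\<And>x. x \<in> verts G \<Longrightarrow> \<phi> x \<in> verts H"
    and "\<And>x y. x \<in> verts G \<Longrightarrow> y \<in> verts G \<Longrightarrow> (x, y) \<in> edges G \<longleftrightarrow> (\<phi> x, \<phi> y) \<in> edges H"
    and "dom (str_map H) = map \<phi> ` dom (str_map G)"
    and "\<And>xs. xs \<in> dom (str_map G) \<Longrightarrow> str_map G xs = str_map H (map \<phi> xs)"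
  using assms by (auto simp: sgraph_iso_def bij_betw_def)

lemma sgraph_iso_comp:
  assumes "sgraph_iso \<phi> G H" "sgraph_iso \<psi> H K"
  shows "sgraph_iso (\<psi> \<circ> \<phi>) G K"
  unfolding sgraph_iso_def
proof (intro conjI ballI)
  note G = sgraph_isoD[OF assms(1)] and H = sgraph_isoD[OF assms(2)]
  show "bij_betw (\<psi> \<circ> \<phi>) (verts G) (verts K)"
    using G(1) H(1) by (rule bij_betw_trans)
  show "(x, y) \<in> edges G \<longleftrightarrow> ((\<psi> \<circ> \<phi>) x, (\<psi> \<circ> \<phi>) y) \<in> edges K"
    if "x \<in> verts G" "y \<in> verts G" for x y
    using G(2,3) H(3) that by simp
  show "dom (str_map K) = map (\<psi> \<circ> \<phi>) ` dom (str_map G)"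
    unfolding H(4) G(4) by (simp add: image_image)
  show "str_map G xs = str_map K (map (\<psi> \<circ> \<phi>) xs)" if "xs \<in> dom (str_map G)" for xs
    using G(5)[OF that] H(5)[of "map \<phi> xs"] that unfolding G(4) by simp
qed

lemma sgraph_iso_inv:
  assumes "sgraph_iso \<phi> G H" "structured_graph G"
  shows "sgraph_iso (inv_into (verts G) \<phi>) H G"
  unfolding sgraph_iso_def
proof (intro conjI ballI)
  let ?\<psi> = "inv_into (verts G) \<phi>"
  note G = sgraph_isoD[OF assms(1)]
  have inv: "map ?\<psi> (map \<phi> xs) = xs" if "xs \<in> dom (str_map G)" for xs
  proof -
    have "set xs \<subseteq> verts G" using assms(2) that unfolding structured_graph_def by auto
    then show ?thesis
      using bij_betw_inv_into_left[OF G(1)] by (auto intro!: map_idI)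
  qed
  show bij: "bij_betw ?\<psi> (verts H) (verts G)"
    by (rule bij_betw_inv_into[OF G(1)])
  show "(x, y) \<in> edges H \<longleftrightarrow> (?\<psi> x, ?\<psi> y) \<in> edges G" if "x \<in> verts H" "y \<in> verts H" for x y
    using G(3)[of "?\<psi> x" "?\<psi> y"] bij_betwE[OF bij] bij_betw_inv_into_right[OF G(1)] that by simp
  show "dom (str_map G) = map ?\<psi> ` dom (str_map H)"
    unfolding G(4) image_image using inv by simp
  show "str_map H xs = str_map G (map ?\<psi> xs)" if xs: "xs \<in> dom (str_map H)" for xs
  proof -
    obtain ys where "ys \<in> dom (str_map G)" "xs = map \<phi> ys" using xs unfolding G(4) by blast
    then show ?thesis using inv[of ys] G(5)[of ys] by (simp del: map_map)
  qed
qed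

lemma ex_nat_copy:
  fixes G :: "'a sgraph"
  assumes "structured_graph G" "finite (verts G)"
  obtains H :: "nat sgraph" and \<phi> where "structured_graph H" "sgraph_iso \<phi> G H"
proof -
  obtain \<phi> :: "'a \<Rightarrow> nat" where inj: "inj_on \<phi> (verts G)"
    using finite_imp_inj_to_nat_seg[OF assms(2)] by blast
  define \<psi> where "\<psi> = inv_into (verts G) \<phi>"
  have \<psi>: "\<psi> (\<phi> x) = x" if "x \<in> verts G" for x
    using inj that by (simp add: \<psi>_def)
  have map\<psi>: "map \<psi> (map \<phi> xs) = xs" if "xs \<in> dom (str_map G)" for xs
  proof -
    have "set xs \<subseteq> verts G" using assms(1) that unfolding structured_graph_def by auto
    then show ?thesis using \<psi> by (auto intro!: map_idI)
  qed
  define H where "H = \<lparr>verts = \<phi> ` verts G, edges = map_prod \<phi> \<phi> ` edges G,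
    str_map = (\<lambda>xs. str_map G (map \<psi> xs)) |` (map \<phi> ` dom (str_map G))\<rparr>"
  have E: "edges G \<subseteq> verts G \<times> verts G" "sym (edges G)" "irrefl (edges G)"
    using assms(1) by (auto simp: structured_graph_def lf_graph_def)
  have dom: "dom (str_map H) = map \<phi> ` dom (str_map G)"
  proof (rule set_eqI)
    show "ys \<in> dom (str_map H) \<longleftrightarrow> ys \<in> map \<phi> ` dom (str_map G)" for ys
    proof (cases "ys \<in> map \<phi> ` dom (str_map G)")
      case True
      then obtain xs where "ys = map \<phi> xs" "xs \<in> dom (str_map G)" by blast
      then show ?thesis using map\<psi>[of xs] True by (auto simp: H_def simp del: map_map)
    next
      case False
      then show ?thesis by (simp add: H_def domIff)
    qed
  qed
  have edge: "(\<phi> x, \<phi> y) \<in> edges H \<longleftrightarrow> (x, y) \<in> edges G" if "x \<in> verts G" "y \<in> verts G" for x y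
  proof
    assume "(\<phi> x, \<phi> y) \<in> edges H"
    then obtain a b where ab: "(a, b) \<in> edges G" "\<phi> x = \<phi> a" "\<phi> y = \<phi> b"
      by (auto simp: H_def)
    then have "a \<in> verts G" "b \<in> verts G" using E(1) by auto
    then show "(x, y) \<in> edges G" using ab \<psi> that by metis
  next
    assume "(x, y) \<in> edges G"
    then have "map_prod \<phi> \<phi> (x, y) \<in> edges H"
      unfolding H_def graph.select_convs by (rule imageI)
    then show "(\<phi> x, \<phi> y) \<in> edges H" by simp
  qed
  have EH: "edges H \<subseteq> verts H \<times> verts H"
  proof
    fix p assume "p \<in> edges H"
    then obtain x y where "(x, y) \<in> edges G" "p = (\<phi> x, \<phi> y)" by (auto simp: H_def)
    then show "p \<in> verts H \<times> verts H" using E(1) by (auto simp: H_def)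
  qed
  have symH: "sym (edges H)"
  proof (rule symI)
    fix a b assume "(a, b) \<in> edges H"
    then obtain x y where xy: "(x, y) \<in> edges G" "a = \<phi> x" "b = \<phi> y"
      by (auto simp: H_def)
    then have "(y, x) \<in> edges G" using E(2) by (auto dest: symD)
    then have "map_prod \<phi> \<phi> (y, x) \<in> edges H"
      unfolding H_def graph.select_convs by (rule imageI)
    then show "(b, a) \<in> edges H" by (simp add: xy)
  qed
  have irr: "irrefl (edges H)"
  proof (rule irreflI)
    show "(z, z) \<notin> edges H" for z
    proof
      assume z: "(z, z) \<in> edges H"
      then obtain x where "x \<in> verts G" "z = \<phi> x" using EH by (auto simp: H_def)
      then show False using z edge E(3) by (simp add: irrefl_def)
    qed
  qed
  have "finite {y. (x, y) \<in> edges H}" for x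
  proof (rule finite_subset)
    show "{y. (x, y) \<in> edges H} \<subseteq> verts H" using EH by auto
    show "finite (verts H)" using assms(2) by (simp add: H_def)
  qed
  then have "lf_graph H"
    using EH symH irr by (simp add: lf_graph_def)
  moreover have "dom (str_map H) \<subseteq> lists (verts H)"
  proof -
    have "set xs \<subseteq> verts G" if "xs \<in> dom (str_map G)" for xs
      using assms(1) that unfolding structured_graph_def by auto
    then have "map \<phi> xs \<in> lists (verts H)" if "xs \<in> dom (str_map G)" for xs
      using that unfolding in_lists_conv_set H_def by auto
    then show ?thesis unfolding dom by blast
  qed
  moreover have "\<exists>l. \<forall>xs\<in>dom (str_map H). length xs \<le> l"
  proof -
    obtain l where "\<forall>xs\<in>dom (str_map G). length xs \<le> l"
      using assms(1) unfolding structured_graph_def by blast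
    then show ?thesis unfolding dom by (intro exI[of _ l]) (simp only: ball_simps length_map)
  qed
  ultimately have "structured_graph H"
    by (simp add: structured_graph_def)
  moreover have "sgraph_iso \<phi> G H"
    unfolding sgraph_iso_def
  proof (intro conjI ballI)
    show "bij_betw \<phi> (verts G) (verts H)"
      using inj by (simp add: H_def bij_betw_def)
    show "str_map G xs = str_map H (map \<phi> xs)" if "xs \<in> dom (str_map G)" for xs
      using that map\<psi>[OF that] by (simp add: H_def del: map_map)
    show "(x, y) \<in> edges G \<longleftrightarrow> (\<phi> x, \<phi> y) \<in> edges H" if "x \<in> verts G" "y \<in> verts G" for x y
      using edge[OF that] by simp
  qed (rule dom)
  ultimately show ?thesis by (rule that)
qed

lemma rooted_class_eq_iff:
  assumes "structured_graph G" "finite (verts G)" "x \<in> verts G"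
    and "structured_graph H" "y \<in> verts H"
  shows "rooted_class G x = rooted_class H y \<longleftrightarrow> (\<exists>\<phi>. sgraph_iso \<phi> G H \<and> \<phi> x = y)"
proof
  assume eq: "rooted_class G x = rooted_class H y"
  obtain K :: "nat sgraph" and \<phi> where K: "structured_graph K" "sgraph_iso \<phi> G K"
    using ex_nat_copy[OF assms(1,2)] by blast
  then have "(K, \<phi> x) \<in> rooted_class H y"
    unfolding eq[symmetric] by (auto simp: rooted_class_def)
  then obtain \<psi> where \<psi>: "sgraph_iso \<psi> H K" "\<psi> y = \<phi> x"
    by (auto simp: rooted_class_def)
  then have "inv_into (verts H) \<psi> (\<phi> x) = y"
    using assms(5) by (metis bij_betw_inv_into_left sgraph_iso_def)
  then show "\<exists>\<phi>. sgraph_iso \<phi> G H \<and> \<phi> x = y"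
    using sgraph_iso_comp[OF K(2) sgraph_iso_inv[OF \<psi>(1) assms(4)]] by auto
next
  assume "\<exists>\<phi>. sgraph_iso \<phi> G H \<and> \<phi> x = y"
  then obtain \<phi> where \<phi>: "sgraph_iso \<phi> G H" "\<phi> x = y" by blast
  have inv: "inv_into (verts G) \<phi> y = x"
    using \<phi> assms(3) by (metis bij_betw_inv_into_left sgraph_iso_def)
  show "rooted_class G x = rooted_class H y"
  proof (intro equalityI subsetI)
    fix p assume "p \<in> rooted_class G x"
    then show "p \<in> rooted_class H y"
      using sgraph_iso_comp[OF sgraph_iso_inv[OF \<phi>(1) assms(1)]] inv
      unfolding rooted_class_def by fastforce
  next
    fix p assume "p \<in> rooted_class H y"
    then show "p \<in> rooted_class G x"
      using sgraph_iso_comp[OF \<phi>(1)] \<phi>(2) unfolding rooted_class_def by fastforce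
  qed
qed

lemma iso_class_eq_iff:
  assumes "structured_graph G" "finite (verts G)" "structured_graph H"
  shows "iso_class G = iso_class H \<longleftrightarrow> (\<exists>\<phi>. sgraph_iso \<phi> G H)"
proof
  assume eq: "iso_class G = iso_class H"
  obtain K :: "nat sgraph" and \<phi> where K: "structured_graph K" "sgraph_iso \<phi> G K"
    using ex_nat_copy[OF assms(1,2)] by blast
  then have "K \<in> iso_class H"
    unfolding eq[symmetric] by (auto simp: iso_class_def)
  then show "\<exists>\<phi>. sgraph_iso \<phi> G H"
    using sgraph_iso_comp[OF K(2) sgraph_iso_inv[OF _ assms(3)]] by (auto simp: iso_class_def)
next
  assume "\<exists>\<phi>. sgraph_iso \<phi> G H"
  then obtain \<phi> where \<phi>: "sgraph_iso \<phi> G H" by blast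
  show "iso_class G = iso_class H"
  proof (intro equalityI subsetI)
    fix K assume "K \<in> iso_class G"
    then show "K \<in> iso_class H"
      using sgraph_iso_comp[OF sgraph_iso_inv[OF \<phi> assms(1)]]
      unfolding iso_class_def by fastforce
  next
    fix K assume "K \<in> iso_class H"
    then show "K \<in> iso_class G"
      using sgraph_iso_comp[OF \<phi>] unfolding iso_class_def by fastforce
  qed
qed


section \<open>LOCAL algorithms and coloring problems\<close>

text \<open>In \<open>add_struct\<close>, \<open>f\<close> is a partial function on vertices, \<open>None\<close> plays the role of the symbol
  for ``undefined'', and the library's \<open>to_nat\<close> serves as the fixed injection into the naturals.\<close>

definition on_singletons :: "('a \<Rightarrow> 'b option) \<Rightarrow> 'a list \<Rightarrow> 'b option" where
  "on_singletons f xs = (case xs of [x] \<Rightarrow> f x | _ \<Rightarrow> None)"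

definition add_struct :: "'a sgraph \<Rightarrow> ('a \<Rightarrow> nat option) \<Rightarrow> 'a sgraph" where
  "add_struct G f = G\<lparr>str_map := (\<lambda>xs.
     if xs \<in> dom (str_map G) \<union> dom (on_singletons f)
     then Some (to_nat (str_map G xs, on_singletons f xs)) else None)\<rparr>"

text \<open>A function defined on all vertices, added to the structure: a HOL function is total on the
  vertex type, so it is first restricted to the vertices.\<close>

definition add_fun :: "'a sgraph \<Rightarrow> ('a \<Rightarrow> nat) \<Rightarrow> 'a sgraph" where
  "add_fun G f = add_struct G ((\<lambda>x. Some (f x)) |` verts G)"

text \<open>Functions on \<open>FSG_rooted\<close> are total HOL functions, of which only the values on
  \<open>FSG_rooted\<close> are ever used.\<close>

type_synonym local_algorithm = "rooted_class \<Rightarrow> nat"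

definition local_output :: "local_algorithm \<Rightarrow> 'a sgraph \<Rightarrow> nat \<Rightarrow> 'a \<Rightarrow> nat" where
  "local_output A G T x = A (rooted_class (sball G x T) x)"

definition local_coloring_problem :: "nat \<times> local_algorithm \<Rightarrow> bool" where
  "local_coloring_problem \<pi> \<longleftrightarrow> (\<forall>c\<in>FSG_rooted. snd \<pi> c \<in> {0, 1})"

definition is_coloring :: "nat \<times> local_algorithm \<Rightarrow> 'a sgraph \<Rightarrow> ('a \<Rightarrow> nat) \<Rightarrow> bool" where
  "is_coloring \<pi> G f \<longleftrightarrow> (\<forall>x\<in>verts G. local_output (snd \<pi>) (add_fun G f) (fst \<pi>) x = 1)"


section \<open>Deterministic complexity and local membership\<close>

text \<open>It suffices to let the \<open>n\<close>-vertex graphs \<open>H\<close> below range over graphs on natural numbers,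
  as all the notions involved are invariant under isomorphism.\<close>

definition Det_le :: "nat \<times> local_algorithm \<Rightarrow> sgraph_class set \<Rightarrow> nat \<Rightarrow> nat \<Rightarrow> bool" where
  "Det_le \<pi> \<G> n T \<longleftrightarrow> (\<exists>A :: local_algorithm. \<forall>(H :: nat sgraph) ids.
     structured_graph H \<and> finite (verts H) \<and> card (verts H) = n \<and> iso_class H \<in> \<G> \<and>
     bij_betw ids (verts H) {1..n} \<longrightarrow>
     is_coloring \<pi> H (local_output A (add_fun H ids) T))"

text \<open>The infimum of the empty set is \<open>\<infinity>\<close>.\<close>

definition Det :: "nat \<times> local_algorithm \<Rightarrow> sgraph_class set \<Rightarrow> nat \<Rightarrow> enat" where
  "Det \<pi> \<G> n = (INF T\<in>{T. Det_le \<pi> \<G> n T}. enat T)"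

definition locally_in :: "'a sgraph \<Rightarrow> nat \<Rightarrow> nat \<Rightarrow> sgraph_class set \<Rightarrow> bool" where
  "locally_in G R n \<G> \<longleftrightarrow> (\<forall>x\<in>verts G. \<exists>(H :: nat sgraph) y.
     structured_graph H \<and> finite (verts H) \<and> card (verts H) = n \<and> iso_class H \<in> \<G> \<and>
     y \<in> verts H \<and> rooted_class (sball G x R) x = rooted_class (sball H y R) y)"


section \<open>Borel structured graphs\<close>

text \<open>A \<open>measure\<close> is used here only as a carrier set with a sigma-algebra.\<close>

definition standard_borel :: "'a measure \<Rightarrow> bool" where
  "standard_borel M \<longleftrightarrow> (\<exists>X. completely_metrizable_space X \<and> separable_space X \<and>
     space M = topspace X \<and> sets M = sigma_sets (topspace X) {U. openin X U})"

text \<open>The Borel sets of the disjoint union of the powers \<open>V\<^sup>k\<close>, a tuple being encoded as a list.\<close>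

definition borel_tuples :: "'a measure \<Rightarrow> 'a list set set" where
  "borel_tuples M = {A. A \<subseteq> lists (space M) \<and>
     (\<forall>k. {v \<in> space (Pi\<^sub>M {..<k} (\<lambda>_. M)). map v [0..<k] \<in> A} \<in> sets (Pi\<^sub>M {..<k} (\<lambda>_. M)))}"

definition borel_graph :: "'a measure \<Rightarrow> ('a, 'b) graph_scheme \<Rightarrow> bool" where
  "borel_graph M G \<longleftrightarrow> lf_graph G \<and> standard_borel M \<and> verts G = space M \<and>
     edges G \<in> sets (M \<Otimes>\<^sub>M M)"

definition borel_structured_graph :: "'a measure \<Rightarrow> 'a sgraph \<Rightarrow> bool" where
  "borel_structured_graph M G \<longleftrightarrow> structured_graph G \<and> borel_graph M G \<and>
     (\<forall>c. {xs. str_map G xs = Some c} \<in> borel_tuples M)"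

definition borel_coloring :: "'a measure \<Rightarrow> nat \<times> local_algorithm \<Rightarrow> 'a sgraph \<Rightarrow> ('a \<Rightarrow> nat) \<Rightarrow> bool"
  where "borel_coloring M \<pi> G f \<longleftrightarrow> is_coloring \<pi> G f \<and> f \<in> measurable M (count_space UNIV)"

end

theory Submission
  imports Defs
begin

text \<open>Put \<open>R = T + t\<close>, where \<open>T\<close> is the deterministic complexity, and let \<open>A\<close> be an algorithm
  that works in \<open>T\<close> rounds on \<open>n\<close>-vertex graphs whose vertices carry the identifiers \<open>1, \<dots>, n\<close>.
  The proof replaces the identifiers by a Borel colouring \<open>c : V \<rightarrow> {1..n}\<close> in which any two distinct
  vertices at distance at most \<open>2 R\<close> get different colours, and runs \<open>A\<close> on \<open>G\<close> together with \<open>c\<close>.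

  The output is a \<open>\<Pi>\<close>-colouring (\<open>local_algorithm_on_proper_coloring\<close>). Whether the constraint
  holds at \<open>x\<close> depends only on the ball of radius \<open>R\<close> around \<open>x\<close> and on the colours \<open>c\<close> in it, and \<open>c\<close>
  is injective there. This ball also occurs in some \<open>n\<close>-vertex graph \<open>H\<close> of the class; transported
  to \<open>H\<close>, the injective colours extend to a bijection from the vertices of \<open>H\<close> onto \<open>{1..n}\<close>. On
  \<open>H\<close> with this bijection the algorithm is correct, and it cannot see the difference near \<open>x\<close>.

  The measurability statements rest on one theorem of descriptive set theory: a Borel relation on a
  standard Borel space whose sections have at most \<open>d\<close> elements is covered, up to the diagonal, by the
  graphs of finitely many Borel functions (\<open>standard_borel_uniformization\<close>). Every nonempty standard Borel
  space is a Borel retract of Baire space (\<open>standard_borel_retract\<close>), so it suffices to treat Baire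
  space. There the case of at most one-element sections is the theorem of Lusin and Souslin that
  injective Borel images are Borel (\<open>lusin_souslin_seq\<close>, \<open>domain_of_unique_sections\<close>), which
  follows from Lusin's separation theorem, and larger sections are treated by splitting off
  their largest elements (\<open>bounded_sections_uniformization\<close>).

  Consequently the ball of radius \<open>r \<le> 2 R\<close> around \<open>x\<close> is \<open>{w x | w \<in> ws}\<close> for a finite list
  \<open>ws\<close> of Borel functions (\<open>nbhd_enumeration\<close>). This gives the Borel colouring \<open>c\<close>, as a
  countable proper colouring made greedy (\<open>countable_proper_coloring\<close>,
  \<open>bounded_proper_coloring\<close>). It also shows that the output of any LOCAL algorithm is Borel
  (\<open>measurable_local_output\<close>): the isomorphism type of the ball is determined by
  finitely many Borel functions of \<open>x\<close> with countably many values.\<close>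

section \<open>Sequence spaces and Lusin separation\<close>

text \<open>The Borel structure of the product \<open>'c\<^sup>\<nat>\<close> of discrete spaces, for countable \<open>'c\<close>; for
  \<open>'c = nat\<close> this is Baire space.\<close>

abbreviation seq_space :: "(nat \<Rightarrow> 'c) measure" where
  "seq_space \<equiv> Pi\<^sub>M UNIV (\<lambda>_. count_space UNIV)"

lemma space_seq_space [simp]: "space seq_space = UNIV"
  by (simp add: space_PiM PiE_UNIV_domain)

lemma UNIV_in_sets_seq_space [simp]: "UNIV \<in> sets seq_space"
  using sets.top[of seq_space] by simp

lemma measurable_seq_component [measurable]:
  "(\<lambda>x. x i) \<in> measurable seq_space (count_space UNIV)"
  by (rule measurable_component_singleton) simp

lemma seq_coordinate_sets: "{x. x i \<in> A} \<in> sets seq_space"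
  using measurable_sets[OF measurable_seq_component[of i], of A] by (simp add: vimage_def)

lemma measurable_into_seq_space:
  assumes "\<And>i. (\<lambda>x. f x i) \<in> measurable N (count_space UNIV)"
  shows "f \<in> measurable N seq_space"
  by (rule measurable_PiM_single') (use assms in auto)

text \<open>Topologically closed sets of sequences, described by finite initial segments so that closed sets
  can be handled through the tree of their initial segments.\<close>

definition seq_closed :: "(nat \<Rightarrow> 'c) set \<Rightarrow> bool" where
  "seq_closed F \<longleftrightarrow> (\<forall>\<gamma>. (\<forall>n. \<exists>\<delta>\<in>F. \<forall>i<n. \<delta> i = \<gamma> i) \<longrightarrow> \<gamma> \<in> F)"

definition cylinder :: "(nat \<Rightarrow> 'c) set \<Rightarrow> 'c list \<Rightarrow> (nat \<Rightarrow> 'c) set" where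
  "cylinder F s = {\<gamma> \<in> F. \<forall>i<length s. \<gamma> i = s ! i}"

definition measurably_separated :: "(nat \<Rightarrow> 'a) set \<Rightarrow> (nat \<Rightarrow> 'a) set \<Rightarrow> bool" where
  "measurably_separated P Q \<longleftrightarrow> (\<exists>D\<in>sets seq_space. P \<subseteq> D \<and> D \<inter> Q = {})"

lemma measurably_separated_UN:
  fixes P :: "'i::countable \<Rightarrow> (nat \<Rightarrow> 'a) set" and Q :: "'j::countable \<Rightarrow> (nat \<Rightarrow> 'a) set"
  assumes "\<And>i j. measurably_separated (P i) (Q j)"
  shows "measurably_separated (\<Union>i. P i) (\<Union>j. Q j)"
proof -
  define D where "D i j = (SOME D. D \<in> sets seq_space \<and> P i \<subseteq> D \<and> D \<inter> Q j = {})" for i j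
  have D: "D i j \<in> sets seq_space \<and> P i \<subseteq> D i j \<and> D i j \<inter> Q j = {}" for i j
    unfolding D_def using assms[of i j] unfolding measurably_separated_def
    by (intro someI_ex[of "\<lambda>D. D \<in> sets seq_space \<and> P i \<subseteq> D \<and> D \<inter> Q j = {}"]) auto
  have "(\<Union>i. \<Inter>j. D i j) \<in> sets seq_space"
    using D by (intro sets.countable_UN sets.countable_INT'') auto
  moreover have "(\<Union>i. P i) \<subseteq> (\<Union>i. \<Inter>j. D i j)"
    using D by (intro UN_mono INT_greatest) simp_all
  moreover have "(\<Union>i. \<Inter>j. D i j) \<inter> (\<Union>j. Q j) = {}"
  proof -
    have False if "x \<in> D i j" "x \<in> Q j" for x i j
      using D[of i j] that by (simp add: disjoint_iff)
    then show ?thesis by (simp add: disjoint_iff) blast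
  qed
  ultimately show ?thesis unfolding measurably_separated_def by (intro bexI conjI)
qed

lemma cylinder_split: "cylinder F s = (\<Union>c. cylinder F (s @ [c]))"
proof (intro equalityI subsetI)
  fix \<gamma> assume "\<gamma> \<in> cylinder F s"
  then have "\<gamma> \<in> cylinder F (s @ [\<gamma> (length s)])"
    by (auto simp: cylinder_def nth_append less_Suc_eq)
  then show "\<gamma> \<in> (\<Union>c. cylinder F (s @ [c]))" by (rule UN_I[OF UNIV_I])
next
  fix \<gamma> assume "\<gamma> \<in> (\<Union>c. cylinder F (s @ [c]))"
  then obtain c where "\<gamma> \<in> cylinder F (s @ [c])" by (rule UN_E)
  then show "\<gamma> \<in> cylinder F s" by (auto simp: cylinder_def nth_append split: if_splits)
qed

lemma cylinder_subset: "cylinder F s \<subseteq> F"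
  by (auto simp: cylinder_def)

text \<open>A chain of lists, each extending the previous one by one entry, has a limit sequence. Together with
  \<open>seq_closed_branch\<close> this is how points of closed sets are constructed.\<close>

lemma branch_of_chain:
  fixes S :: "nat \<Rightarrow> 'c list"
  assumes "\<And>n. length (S n) = n" and "\<And>n. \<exists>c. S (Suc n) = S n @ [c]"
  shows "\<exists>\<gamma>. \<forall>n. \<forall>i<n. S n ! i = \<gamma> i"
proof (intro exI allI impI)
  fix n i :: nat assume "i < n"
  then show "S n ! i = S (Suc i) ! i"
  proof (induction n)
    case (Suc n)
    obtain c where c: "S (Suc n) = S n @ [c]" using assms(2) by blast
    show ?case
    proof (cases "i = n")
      case False
      then have "i < n" using Suc.prems by simp
      then show ?thesis using Suc.IH assms(1)[of n] by (simp add: c nth_append)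
    qed simp
  qed simp
qed

lemma seq_closed_branch:
  assumes "seq_closed F" "\<And>n. length (S n) = n" "\<And>n i. i < n \<Longrightarrow> S n ! i = \<gamma> i"
    and "\<And>n. cylinder F (S n) \<noteq> {}"
  shows "\<gamma> \<in> F"
proof -
  have "\<exists>\<delta>\<in>F. \<forall>i<n. \<delta> i = \<gamma> i" for n
  proof -
    obtain \<delta> where "\<delta> \<in> cylinder F (S n)" using assms(4)[of n] by blast
    then show ?thesis
      using assms(2)[of n] assms(3)[of _ n] by (intro bexI[of _ \<delta>]) (auto simp: cylinder_def)
  qed
  then show ?thesis using assms(1) by (simp add: seq_closed_def)
qed

text \<open>If the two images could not be separated, then, since countable unions preserve separation, there
  would be arbitrarily long initial segments \<open>s\<close>, \<open>s'\<close>, each extending the one before, such that the images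
  of the corresponding cylinders cannot be separated either. In the limit they produce points of \<open>F\<close>
  and \<open>F'\<close>, whose images differ in some coordinate; as soon as the segments contain this coordinate, it
  separates the images.\<close>

lemma lusin_separation:
  fixes F F' :: "(nat \<Rightarrow> 'c::countable) set" and \<pi> :: "'c \<Rightarrow> 'a"
  assumes "seq_closed F" "seq_closed F'"
    and disj: "(\<lambda>\<gamma>. \<pi> \<circ> \<gamma>) ` F \<inter> (\<lambda>\<gamma>. \<pi> \<circ> \<gamma>) ` F' = {}"
  shows "measurably_separated ((\<lambda>\<gamma>. \<pi> \<circ> \<gamma>) ` F) ((\<lambda>\<gamma>. \<pi> \<circ> \<gamma>) ` F')"
proof (rule ccontr)
  assume non: "\<not> ?thesis"
  define im where "im F s = (\<lambda>\<gamma>. \<pi> \<circ> \<gamma>) ` cylinder F s" for F s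
  have im_split: "im F s = (\<Union>c. im F (s @ [c]))" for F s
    unfolding im_def by (subst cylinder_split) (rule image_UN)
  let ?bad = "\<lambda>n p. length (fst p) = n \<and> length (snd p) = n \<and>
    \<not> measurably_separated (im F (fst p)) (im F' (snd p))"
  let ?ext = "\<lambda>p q. (\<exists>c. fst q = fst p @ [c]) \<and> (\<exists>c. snd q = snd p @ [c])"
  have "\<exists>S. \<forall>n. ?bad n (S n) \<and> ?ext (S n) (S (Suc n))"
  proof (rule dependent_nat_choice)
    have "im F [] = (\<lambda>\<gamma>. \<pi> \<circ> \<gamma>) ` F" for F by (simp add: im_def cylinder_def)
    then show "\<exists>p. ?bad 0 p" using non by (intro exI[of _ "([], [])"]) simp
  next
    fix p n assume p: "?bad n p"
    then have "\<not> measurably_separated (\<Union>c. im F (fst p @ [c])) (\<Union>c. im F' (snd p @ [c]))"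
      using im_split[of F "fst p"] im_split[of F' "snd p"] by simp
    then obtain c c' where "\<not> measurably_separated (im F (fst p @ [c])) (im F' (snd p @ [c']))"
      using measurably_separated_UN[of "\<lambda>c. im F (fst p @ [c])" "\<lambda>c. im F' (snd p @ [c])"] by blast
    then show "\<exists>q. ?bad (Suc n) q \<and> ?ext p q"
      using p by (intro exI[of _ "(fst p @ [c], snd p @ [c'])"]) simp
  qed
  then obtain S where S: "\<And>n. ?bad n (S n)" "\<And>n. ?ext (S n) (S (Suc n))" by blast
  have "\<exists>\<gamma>. \<forall>n. \<forall>i<n. fst (S n) ! i = \<gamma> i"
  proof (rule branch_of_chain)
    show "length (fst (S n)) = n" "\<exists>c. fst (S (Suc n)) = fst (S n) @ [c]" for n
      using S(1)[of n] S(2)[of n] by blast+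
  qed
  then obtain \<gamma> where \<gamma>: "\<And>n i. i < n \<Longrightarrow> fst (S n) ! i = \<gamma> i" by blast
  have "\<exists>\<gamma>. \<forall>n. \<forall>i<n. snd (S n) ! i = \<gamma> i"
  proof (rule branch_of_chain)
    show "length (snd (S n)) = n" "\<exists>c. snd (S (Suc n)) = snd (S n) @ [c]" for n
      using S(1)[of n] S(2)[of n] by blast+
  qed
  then obtain \<gamma>' where \<gamma>': "\<And>n i. i < n \<Longrightarrow> snd (S n) ! i = \<gamma>' i" by blast
  have sep0: "measurably_separated {} Q" "measurably_separated P {}" for P Q :: "(nat \<Rightarrow> 'a) set"
    using sets.top[of "seq_space :: (nat \<Rightarrow> 'a) measure"] unfolding measurably_separated_def
    by (auto intro: bexI[of _ "{}"] bexI[of _ UNIV])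
  have "cylinder F (fst (S n)) \<noteq> {}" "cylinder F' (snd (S n)) \<noteq> {}" for n
    using S(1)[of n] sep0(1)[of "im F' (snd (S n))"] sep0(2)[of "im F (fst (S n))"]
    by (auto simp: im_def)
  moreover have "length (fst (S n)) = n" "length (snd (S n)) = n" for n
    using S(1)[of n] by blast+
  ultimately have "\<gamma> \<in> F" "\<gamma>' \<in> F'"
    using seq_closed_branch[OF assms(1), of "\<lambda>n. fst (S n)", OF _ \<gamma>]
      seq_closed_branch[OF assms(2), of "\<lambda>n. snd (S n)", OF _ \<gamma>'] by simp_all
  then have "\<pi> \<circ> \<gamma> \<noteq> \<pi> \<circ> \<gamma>'" using disj by (auto simp: image_def)
  then obtain i where i: "\<pi> (\<gamma> i) \<noteq> \<pi> (\<gamma>' i)" by (auto simp: fun_eq_iff)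
  have "measurably_separated (im F (fst (S (Suc i)))) (im F' (snd (S (Suc i))))"
    unfolding measurably_separated_def
  proof (intro bexI conjI)
    show "im F (fst (S (Suc i))) \<subseteq> {x. x i \<in> {\<pi> (\<gamma> i)}}"
      using \<gamma>[of i "Suc i"] S(1)[of "Suc i"] by (auto simp: im_def cylinder_def)
    show "{x. x i \<in> {\<pi> (\<gamma> i)}} \<inter> im F' (snd (S (Suc i))) = {}"
      using \<gamma>'[of i "Suc i"] S(1)[of "Suc i"] i by (auto simp: im_def cylinder_def)
    show "{x. x i \<in> {\<pi> (\<gamma> i)}} \<in> sets seq_space"
      by (rule seq_coordinate_sets)
  qed
  then show False using S(1)[of "Suc i"] by simp
qed

lemma seq_closed_cylinder:
  assumes "seq_closed F"
  shows "seq_closed (cylinder F s)"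
  unfolding seq_closed_def
proof (intro allI impI)
  fix \<gamma> assume *: "\<forall>n. \<exists>\<delta>\<in>cylinder F s. \<forall>i<n. \<delta> i = \<gamma> i"
  then have "\<forall>n. \<exists>\<delta>\<in>F. \<forall>i<n. \<delta> i = \<gamma> i" using cylinder_subset[of F s] by blast
  then have "\<gamma> \<in> F" using assms by (simp add: seq_closed_def)
  moreover obtain \<delta> where "\<delta> \<in> cylinder F s" "\<forall>i<length s. \<delta> i = \<gamma> i" using * by blast
  ultimately show "\<gamma> \<in> cylinder F s" by (simp add: cylinder_def)
qed

text \<open>The images of the cylinders of a fixed length are pairwise disjoint by injectivity, so Lusin
  separation encloses them in pairwise disjoint Borel sets \<open>B s\<close>. A point that at every length
  lies in some \<open>B s\<close> (and in the \<open>B\<close> of all initial segments of \<open>s\<close>) then selects exactly one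
  list of each length. These lists cohere into a branch, which lies in \<open>F\<close> because
  \<open>F\<close> is closed. Hence the image is a countable intersection of countable unions of Borel sets.\<close>

lemma lusin_souslin_seq:
  fixes F :: "(nat \<Rightarrow> 'c::countable) set" and \<pi> :: "'c \<Rightarrow> 'a"
  assumes F: "seq_closed F" and inj: "inj_on (\<lambda>\<gamma>. \<pi> \<circ> \<gamma>) F"
  shows "(\<lambda>\<gamma>. \<pi> \<circ> \<gamma>) ` F \<in> sets seq_space"
proof -
  define im where "im s = (\<lambda>\<gamma>. \<pi> \<circ> \<gamma>) ` cylinder F s" for s
  have im_disj: "im s \<inter> im s' = {}" if "length s = length s'" "s \<noteq> s'" for s s'
  proof -
    have "\<exists>i<length s. s ! i \<noteq> s' ! i" using that nth_equalityI[of s s'] by blast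
    then have "cylinder F s \<inter> cylinder F s' = {}" using that by (auto simp: cylinder_def)
    then show ?thesis
      using inj_on_image_Int[OF inj cylinder_subset[of F s] cylinder_subset[of F s']]
      unfolding im_def by simp
  qed
  define D where "D s s' = (SOME D. D \<in> sets seq_space \<and> im s \<subseteq> D \<and> D \<inter> im s' = {})" for s s'
  have D: "D s s' \<in> sets seq_space \<and> im s \<subseteq> D s s' \<and> D s s' \<inter> im s' = {}"
    if "length s = length s'" "s \<noteq> s'" for s s'
  proof -
    have "measurably_separated (im s) (im s')"
      using lusin_separation[OF seq_closed_cylinder[OF F] seq_closed_cylinder[OF F]]
        im_disj[OF that] unfolding im_def by blast
    then show ?thesis
      unfolding D_def measurably_separated_def
      by (intro someI_ex[of "\<lambda>D. D \<in> sets seq_space \<and> im s \<subseteq> D \<and> D \<inter> im s' = {}"]) auto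
  qed
  define B where "B s = (if im s = {} then {} else
    (\<Inter>i\<in>{..<length s}. {x. x i \<in> {\<pi> (s ! i)}}) \<inter>
    (\<Inter>s'. if length s = length s' \<and> s \<noteq> s' then D s s' - D s' s else UNIV))" for s
  have B_meas: "B s \<in> sets seq_space" for s
  proof -
    have "(\<Inter>i\<in>{..<length s}. {x. x i \<in> {\<pi> (s ! i)}}) \<in> sets seq_space"
      using sets.top[of seq_space]
      by (cases "length s = 0") (simp_all, intro sets.finite_INT,
        auto intro: seq_coordinate_sets[of _ "{_}", simplified])
    moreover have "(\<Inter>s'. if length s = length s' \<and> s \<noteq> s' then D s s' - D s' s else UNIV)
        \<in> sets seq_space"
      using D sets.top[of seq_space] by (intro sets.countable_INT'') (auto intro!: sets.Diff)
    ultimately show ?thesis unfolding B_def by (simp add: sets.Int)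
  qed
  have im_B: "im s \<subseteq> B s" for s
  proof
    fix x assume x: "x \<in> im s"
    have "x \<in> D s s' - D s' s" if "length s = length s'" "s \<noteq> s'" for s'
      using D[of s s'] D[of s' s] that x by auto
    moreover have "\<forall>i<length s. x i = \<pi> (s ! i)" using x by (auto simp: im_def cylinder_def)
    ultimately show "x \<in> B s" using x unfolding B_def by auto
  qed
  have B_coord: "x i = \<pi> (s ! i)" if "x \<in> B s" "i < length s" for x s i
    using that by (simp add: B_def split: if_splits)
  have B_D: "B s \<subseteq> D s s' - D s' s" if "length s = length s'" "s \<noteq> s'" for s s'
  proof -
    have "B s \<subseteq> (\<Inter>s'. if length s = length s' \<and> s \<noteq> s' then D s s' - D s' s else UNIV)"
      unfolding B_def by (cases "im s = {}") simp_all
    also have "\<dots> \<subseteq> (if length s = length s' \<and> s \<noteq> s' then D s s' - D s' s else UNIV)"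
      by (rule INT_lower) simp
    finally show ?thesis using that by simp
  qed
  have B_unique: "s = s'" if "x \<in> B s" "x \<in> B s'" "length s = length s'" for x s s'
    using that B_D[of s s'] B_D[of s' s] by (cases "s = s'") auto
  have "(\<lambda>\<gamma>. \<pi> \<circ> \<gamma>) ` F =
      (\<Inter>n. \<Union>s. if length s = n then (\<Inter>k. B (take k s)) else {})"
    (is "?P = ?Q")
  proof
    show "?P \<subseteq> ?Q"
    proof
      fix x assume "x \<in> ?P"
      then obtain \<gamma> where \<gamma>: "\<gamma> \<in> F" "x = \<pi> \<circ> \<gamma>" by blast
      have "x \<in> B (take k (map \<gamma> [0..<n]))" for k n
      proof -
        have "\<gamma> \<in> cylinder F (take k (map \<gamma> [0..<n]))" using \<gamma> by (simp add: cylinder_def)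
        then show ?thesis using im_B \<gamma>(2) unfolding im_def by blast
      qed
      then have "\<exists>s. length s = n \<and> (\<forall>k. x \<in> B (take k s))" for n
        by (intro exI[of _ "map \<gamma> [0..<n]"]) simp
      then show "x \<in> ?Q" by auto
    qed
    show "?Q \<subseteq> ?P"
    proof
      fix x assume "x \<in> ?Q"
      then have "\<forall>n. \<exists>s. length s = n \<and> (\<forall>k. x \<in> B (take k s))"
        by (auto split: if_splits)
      then obtain S where S: "\<And>n. length (S n) = n" "\<And>n k. x \<in> B (take k (S n))"
        by metis
      have SB: "x \<in> B (S n)" for n using S(2)[of n n] S(1)[of n] by simp
      have step: "S (Suc n) = S n @ [last (S (Suc n))]" for n
      proof -
        have "take n (S (Suc n)) = S n"
          using B_unique[OF S(2)[of n "Suc n"] SB[of n]] S(1) by simp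
        then show ?thesis
          using S(1)[of "Suc n"]
          by (metis append_butlast_last_id butlast_conv_take diff_Suc_1 length_0_conv nat.simps(3))
      qed
      then have "\<exists>\<gamma>. \<forall>n. \<forall>i<n. S n ! i = \<gamma> i"
        using branch_of_chain[of S, OF S(1)] by blast
      then obtain \<gamma> where \<gamma>: "\<And>n i. i < n \<Longrightarrow> S n ! i = \<gamma> i" by blast
      have "cylinder F (S n) \<noteq> {}" for n
        using SB[of n] unfolding B_def im_def by (cases "cylinder F (S n) = {}") simp_all
      then have "\<gamma> \<in> F" using seq_closed_branch[OF F S(1) \<gamma>] by blast
      moreover have "x i = \<pi> (\<gamma> i)" for i
        using B_coord(1)[OF SB[of "Suc i"], of i] S(1)[of "Suc i"] \<gamma>[of i "Suc i"] by simp
      ultimately show "x \<in> ?P" by (auto simp: fun_eq_iff)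
    qed
  qed
  also have "?Q \<in> sets seq_space"
    using B_meas by (intro sets.countable_INT'' sets.countable_UN'') auto
  finally show ?thesis .
qed

section \<open>Borel sets as injective projections of closed sets\<close>

text \<open>Pairs \<open>(x, \<alpha>)\<close> of sequences are coded as one sequence of pairs.\<close>

definition inj_projection :: "(nat \<Rightarrow> 'a) set \<Rightarrow> bool" where
  "inj_projection E \<longleftrightarrow> (\<exists>F :: (nat \<Rightarrow> 'a \<times> nat) set.
     seq_closed F \<and> inj_on (\<lambda>\<gamma>. fst \<circ> \<gamma>) F \<and> (\<lambda>\<gamma>. fst \<circ> \<gamma>) ` F = E)"

text \<open>Under the coding of pairs of sequences, the map \<open>(x, \<alpha>) \<mapsto> (x, \<alpha> \<circ> k)\<close>. It extracts one of
  countably many sequences that have been interleaved into \<open>\<alpha>\<close>.\<close>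

definition reindex :: "(nat \<Rightarrow> nat) \<Rightarrow> (nat \<Rightarrow> 'a \<times> 'b) \<Rightarrow> nat \<Rightarrow> 'a \<times> 'b" where
  "reindex k \<gamma> n = (fst (\<gamma> n), snd (\<gamma> (k n)))"

lemma fst_comp_reindex [simp]: "fst \<circ> reindex k \<gamma> = fst \<circ> \<gamma>"
  by (simp add: fun_eq_iff reindex_def)

lemma seq_closed_reindex:
  assumes "seq_closed F"
  shows "seq_closed {\<gamma>. reindex k \<gamma> \<in> F}"
  unfolding seq_closed_def
proof (intro allI impI)
  fix \<gamma> assume *: "\<forall>n. \<exists>\<delta>\<in>{\<gamma>. reindex k \<gamma> \<in> F}. \<forall>i<n. \<delta> i = \<gamma> i"
  have "\<exists>\<delta>\<in>F. \<forall>i<n. \<delta> i = reindex k \<gamma> i" for n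
  proof -
    obtain \<delta> where \<delta>: "reindex k \<delta> \<in> F" "\<forall>i<n + (\<Sum>i<n. Suc (k i)). \<delta> i = \<gamma> i"
      using * by blast
    have "\<delta> i = \<gamma> i \<and> \<delta> (k i) = \<gamma> (k i)" if "i < n" for i
      using \<delta>(2) member_le_sum[of i "{..<n}" "\<lambda>i. Suc (k i)"] that by simp
    then show ?thesis using \<delta>(1) by (intro bexI[of _ "reindex k \<delta>"]) (auto simp: reindex_def)
  qed
  then show "\<gamma> \<in> {\<gamma>. reindex k \<gamma> \<in> F}" using assms by (simp add: seq_closed_def)
qed

lemma seq_closed_INT:
  assumes "\<And>i. seq_closed (F i)"
  shows "seq_closed (\<Inter>i. F i)"
  unfolding seq_closed_def
proof (intro allI impI INT_I)
  fix \<gamma> i assume *: "\<forall>n. \<exists>\<delta>\<in>\<Inter>i. F i. \<forall>i<n. \<delta> i = \<gamma> i"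
  have "\<forall>n. \<exists>\<delta>\<in>F i. \<forall>i<n. \<delta> i = \<gamma> i"
  proof
    fix n
    obtain \<delta> where "\<delta> \<in> (\<Inter>i. F i)" "\<forall>i<n. \<delta> i = \<gamma> i" using * by blast
    then show "\<exists>\<delta>\<in>F i. \<forall>i<n. \<delta> i = \<gamma> i" by (intro bexI[of _ \<delta>]) auto
  qed
  then show "\<gamma> \<in> F i" using assms[of i] by (simp add: seq_closed_def)
qed

text \<open>Witnesses \<open>\<alpha>\<^sub>i\<close> for all the memberships \<open>x \<in> E i\<close> are interleaved into a single
  sequence by the pairing function. Each of them is determined by \<open>x\<close>, and so is the interleaved one.\<close>

lemma inj_projection_INT:
  fixes E :: "nat \<Rightarrow> (nat \<Rightarrow> 'a) set"
  assumes "\<And>i. inj_projection (E i)"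
  shows "inj_projection (\<Inter>i. E i)"
proof -
  have "\<forall>i. \<exists>F :: (nat \<Rightarrow> 'a \<times> nat) set.
     seq_closed F \<and> inj_on (\<lambda>\<gamma>. fst \<circ> \<gamma>) F \<and> (\<lambda>\<gamma>. fst \<circ> \<gamma>) ` F = E i"
    using assms by (simp add: inj_projection_def)
  from choice[OF this] obtain F :: "nat \<Rightarrow> (nat \<Rightarrow> 'a \<times> nat) set" where
    F: "\<And>i. seq_closed (F i)" "\<And>i. inj_on (\<lambda>\<gamma>. fst \<circ> \<gamma>) (F i)"
      "\<And>i. (\<lambda>\<gamma>. fst \<circ> \<gamma>) ` F i = E i" by blast
  let ?r = "\<lambda>i. reindex (\<lambda>n. prod_encode (i, n))"
  define C where "C = (\<Inter>i. {\<gamma>. ?r i \<gamma> \<in> F i})"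
  show ?thesis
    unfolding inj_projection_def
  proof (intro exI conjI)
    show "seq_closed C"
      unfolding C_def by (intro seq_closed_INT seq_closed_reindex F)
    show "inj_on (\<lambda>\<gamma>. fst \<circ> \<gamma>) C"
    proof (rule inj_onI)
      fix \<gamma> \<delta> assume *: "\<gamma> \<in> C" "\<delta> \<in> C" "fst \<circ> \<gamma> = fst \<circ> \<delta>"
      have "?r i \<gamma> = ?r i \<delta>" for i
        using * by (intro inj_onD[OF F(2)[of i]]) (auto simp: C_def)
      then have eq: "snd (\<gamma> (prod_encode (i, n))) = snd (\<delta> (prod_encode (i, n)))" for i n
        by (metis reindex_def snd_conv)
      have "snd (\<gamma> m) = snd (\<delta> m)" for m
        using eq[of "fst (prod_decode m)" "snd (prod_decode m)"] by simp
      moreover have "fst (\<gamma> m) = fst (\<delta> m)" for m using *(3) by (simp add: fun_eq_iff)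
      ultimately show "\<gamma> = \<delta>" by (simp add: fun_eq_iff prod_eq_iff)
    qed
    show "(\<lambda>\<gamma>. fst \<circ> \<gamma>) ` C = (\<Inter>i. E i)"
    proof (intro equalityI subsetI)
      fix x assume "x \<in> (\<lambda>\<gamma>. fst \<circ> \<gamma>) ` C"
      then obtain \<gamma> where \<gamma>: "\<gamma> \<in> C" "x = fst \<circ> \<gamma>" by blast
      show "x \<in> (\<Inter>i. E i)"
      proof
        fix i
        have "?r i \<gamma> \<in> F i" using \<gamma> by (simp add: C_def)
        then have "fst \<circ> ?r i \<gamma> \<in> E i" using F(3)[of i] by blast
        then show "x \<in> E i" using \<gamma>(2) by simp
      qed
    next
      fix x assume "x \<in> (\<Inter>i. E i)"
      then have "x \<in> (\<lambda>\<gamma>. fst \<circ> \<gamma>) ` F i" for i using F(3)[of i] by simp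
      then have "\<forall>i. \<exists>\<gamma>. \<gamma> \<in> F i \<and> fst \<circ> \<gamma> = x" by (simp add: image_iff) metis
      from choice[OF this] obtain g where g: "\<And>i. g i \<in> F i" "\<And>i. fst \<circ> g i = x" by blast
      define \<gamma> where "\<gamma> m = (x m, snd (g (fst (prod_decode m)) (snd (prod_decode m))))" for m
      have "?r i \<gamma> = g i" for i
        using g(2)[of i] by (auto simp: fun_eq_iff reindex_def \<gamma>_def prod_eq_iff)
      then have "\<gamma> \<in> C" using g(1) by (simp add: C_def)
      moreover have "x = fst \<circ> \<gamma>" by (simp add: \<gamma>_def fun_eq_iff)
      ultimately show "x \<in> (\<lambda>\<gamma>. fst \<circ> \<gamma>) ` C" by (intro rev_image_eqI[of \<gamma>])
    qed
  qed
qed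

text \<open>The first entry of the second sequence names the set \<open>E i\<close> that contains \<open>x\<close>, and the rest is the
  witness for \<open>E i\<close>. Disjointness makes the first entry unique.\<close>

lemma inj_projection_disjoint_UN:
  fixes E :: "nat \<Rightarrow> (nat \<Rightarrow> 'a) set"
  assumes "\<And>i. inj_projection (E i)" and disj: "\<And>i j. i \<noteq> j \<Longrightarrow> E i \<inter> E j = {}"
  shows "inj_projection (\<Union>i. E i)"
proof -
  have "\<forall>i. \<exists>F :: (nat \<Rightarrow> 'a \<times> nat) set.
     seq_closed F \<and> inj_on (\<lambda>\<gamma>. fst \<circ> \<gamma>) F \<and> (\<lambda>\<gamma>. fst \<circ> \<gamma>) ` F = E i"
    using assms(1) by (simp add: inj_projection_def)
  from choice[OF this] obtain F :: "nat \<Rightarrow> (nat \<Rightarrow> 'a \<times> nat) set" where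
    F: "\<And>i. seq_closed (F i)" "\<And>i. inj_on (\<lambda>\<gamma>. fst \<circ> \<gamma>) (F i)"
      "\<And>i. (\<lambda>\<gamma>. fst \<circ> \<gamma>) ` F i = E i" by blast
  define C where "C = {\<gamma>. reindex Suc \<gamma> \<in> F (snd (\<gamma> 0))}"
  have C_E: "fst \<circ> \<gamma> \<in> E (snd (\<gamma> 0))" if "\<gamma> \<in> C" for \<gamma>
  proof -
    have "fst \<circ> reindex Suc \<gamma> \<in> E (snd (\<gamma> 0))"
      using that F(3)[of "snd (\<gamma> 0)"] unfolding C_def by blast
    then show ?thesis by simp
  qed
  show ?thesis
    unfolding inj_projection_def
  proof (intro exI conjI)
    show "seq_closed C"
      unfolding seq_closed_def
    proof (intro allI impI)
      fix \<gamma> assume *: "\<forall>n. \<exists>\<delta>\<in>C. \<forall>i<n. \<delta> i = \<gamma> i"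
      let ?F = "{\<delta>. reindex Suc \<delta> \<in> F (snd (\<gamma> 0))}"
      have "\<exists>\<delta>\<in>?F. \<forall>i<n. \<delta> i = \<gamma> i" for n
      proof -
        obtain \<delta> where "\<delta> \<in> C" "\<forall>i<Suc n. \<delta> i = \<gamma> i" using * by blast
        then show ?thesis by (intro bexI[of _ \<delta>]) (auto simp: C_def)
      qed
      then have "\<gamma> \<in> ?F" using seq_closed_reindex[OF F(1)] unfolding seq_closed_def by blast
      then show "\<gamma> \<in> C" by (simp add: C_def)
    qed
    show "inj_on (\<lambda>\<gamma>. fst \<circ> \<gamma>) C"
    proof (rule inj_onI)
      fix \<gamma> \<delta> assume *: "\<gamma> \<in> C" "\<delta> \<in> C" "fst \<circ> \<gamma> = fst \<circ> \<delta>"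
      have 0: "snd (\<gamma> 0) = snd (\<delta> 0)"
        using C_E[OF *(1)] C_E[OF *(2)] *(3) disj[of "snd (\<gamma> 0)" "snd (\<delta> 0)"] by auto
      have "reindex Suc \<gamma> = reindex Suc \<delta>"
        using * 0 by (intro inj_onD[OF F(2)[of "snd (\<delta> 0)"]]) (auto simp: C_def)
      then have "snd (\<gamma> (Suc n)) = snd (\<delta> (Suc n))" for n by (metis reindex_def snd_conv)
      then have "snd (\<gamma> m) = snd (\<delta> m)" for m using 0 by (cases m) auto
      moreover have "fst (\<gamma> m) = fst (\<delta> m)" for m using *(3) by (simp add: fun_eq_iff)
      ultimately show "\<gamma> = \<delta>" by (simp add: fun_eq_iff prod_eq_iff)
    qed
    show "(\<lambda>\<gamma>. fst \<circ> \<gamma>) ` C = (\<Union>i. E i)"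
    proof (intro equalityI subsetI)
      fix x assume "x \<in> (\<lambda>\<gamma>. fst \<circ> \<gamma>) ` C"
      then obtain \<gamma> where "\<gamma> \<in> C" "x = fst \<circ> \<gamma>" by blast
      then show "x \<in> (\<Union>i. E i)" using C_E[of \<gamma>] by blast
    next
      fix x assume "x \<in> (\<Union>i. E i)"
      then obtain i where "x \<in> E i" by blast
      then obtain g where g: "g \<in> F i" "x = fst \<circ> g" using F(3)[of i] by blast
      define \<gamma> where "\<gamma> m = (x m, case m of 0 \<Rightarrow> i | Suc n \<Rightarrow> snd (g n))" for m
      have "reindex Suc \<gamma> = g"
        using g(2) by (auto simp: fun_eq_iff reindex_def \<gamma>_def prod_eq_iff)
      then have "\<gamma> \<in> C" using g(1) by (simp add: C_def \<gamma>_def)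
      moreover have "x = fst \<circ> \<gamma>" by (simp add: \<gamma>_def fun_eq_iff)
      ultimately show "x \<in> (\<lambda>\<gamma>. fst \<circ> \<gamma>) ` C" by (intro rev_image_eqI[of \<gamma>])
    qed
  qed
qed

lemma inj_projection_coordinate: "inj_projection {x. x i \<in> A}"
  unfolding inj_projection_def
proof (intro exI conjI)
  let ?F = "{\<gamma> :: nat \<Rightarrow> 'a \<times> nat. fst (\<gamma> i) \<in> A \<and> (\<forall>n. snd (\<gamma> n) = 0)}"
  show "seq_closed ?F"
    unfolding seq_closed_def
  proof (intro allI impI)
    fix \<gamma> assume *: "\<forall>n. \<exists>\<delta>\<in>?F. \<forall>i<n. \<delta> i = \<gamma> i"
    have "fst (\<gamma> i) \<in> A \<and> snd (\<gamma> n) = 0" for n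
    proof -
      obtain \<delta> where "\<delta> \<in> ?F" "\<forall>j<Suc (i + n). \<delta> j = \<gamma> j" using * by blast
      moreover from this have "\<delta> i = \<gamma> i" "\<delta> n = \<gamma> n" by simp_all
      ultimately show ?thesis by (metis (mono_tags, lifting) mem_Collect_eq)
    qed
    then show "\<gamma> \<in> ?F" by simp
  qed
  show "inj_on (\<lambda>\<gamma>. fst \<circ> \<gamma>) ?F"
    by (rule inj_onI) (auto simp: fun_eq_iff prod_eq_iff)
  show "(\<lambda>\<gamma>. fst \<circ> \<gamma>) ` ?F = {x. x i \<in> A}"
  proof (intro equalityI subsetI)
    fix x assume "x \<in> {x. x i \<in> A}"
    then show "x \<in> (\<lambda>\<gamma>. fst \<circ> \<gamma>) ` ?F"
      by (intro rev_image_eqI[of "\<lambda>n. (x n, 0)"]) (auto simp: fun_eq_iff)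
  qed auto
qed

text \<open>The sets that are injective projections together with their complements form a sigma-algebra: a
  countable union becomes disjoint after subtracting earlier sets, and its complement is
  a countable intersection.\<close>

lemma inj_projection_of_sets:
  assumes "E \<in> sets seq_space"
  shows "inj_projection E"
proof -
  let ?G = "{{f \<in> UNIV. f i \<in> A} | i A. i \<in> (UNIV :: nat set) \<and> A \<in> sets (count_space UNIV)}"
  have "E \<in> sigma_sets UNIV ?G"
    using assms unfolding sets_PiM_single by (simp add: PiE_UNIV_domain)
  then have "inj_projection E \<and> inj_projection (- E)"
  proof (induction rule: sigma_sets.induct)
    case (Basic a)
    then obtain i A where "a = {x. x i \<in> A}" by auto
    moreover from this have "- a = {x. x i \<in> - A}" by auto
    ultimately show ?case by (simp only: inj_projection_coordinate)
  next
    case Empty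
    show ?case using inj_projection_coordinate[of 0 "{}"] inj_projection_coordinate[of 0 UNIV]
      by simp
  next
    case (Compl a)
    then show ?case by (simp add: Compl_eq_Diff_UNIV[symmetric])
  next
    case (Union a)
    define b where "b i = (\<Inter>j. if j < i then - a j else a i)" for i
    have b_sub: "b i \<subseteq> (if j < i then - a j else a i)" for i j
      unfolding b_def by (rule INT_lower) simp
    have "inj_projection (\<Inter>i. - a i)"
      using Union.IH by (intro inj_projection_INT) simp
    moreover have "inj_projection (b i)" for i
      unfolding b_def using Union.IH by (intro inj_projection_INT) simp
    then have "inj_projection (\<Union>i. b i)"
    proof (rule inj_projection_disjoint_UN)
      have "b i \<inter> b j = {}" if "i < j" for i j
      proof -
        have "b i \<subseteq> (if i < i then - a i else a i)" "b j \<subseteq> (if i < j then - a i else a j)"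
          by (rule b_sub)+
        then have "b i \<subseteq> a i" "b j \<subseteq> - a i" using that by simp_all
        then show ?thesis by blast
      qed
      then show "b i \<inter> b j = {}" if "i \<noteq> j" for i j
        using that by (metis Int_commute nat_neq_iff)
    qed
    moreover have "(\<Union>i. b i) = (\<Union>i. a i)"
    proof (intro equalityI subsetI)
      fix x assume "x \<in> (\<Union>i. a i)"
      then obtain k where "x \<in> a k" by blast
      define i where "i = (LEAST k. x \<in> a k)"
      have "x \<in> a i" unfolding i_def using \<open>x \<in> a k\<close> by (rule LeastI)
      moreover have "x \<notin> a j" if "j < i" for j
        using that not_less_Least unfolding i_def by blast
      ultimately have "x \<in> b i" by (auto simp: b_def)
      then show "x \<in> (\<Union>i. b i)" by blast
    next
      fix x assume "x \<in> (\<Union>i. b i)"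
      then obtain i where "x \<in> b i" by blast
      then show "x \<in> (\<Union>i. a i)" using b_sub[of i i] by auto
    qed
    ultimately show ?case by simp
  qed
  then show ?thesis by blast
qed

text \<open>The relation is an injective projection of a closed set; since the first component determines
  the second one, so is its domain, and \<open>lusin_souslin_seq\<close> applies.\<close>

lemma domain_of_unique_sections:
  fixes E :: "((nat \<Rightarrow> nat) \<times> (nat \<Rightarrow> nat)) set"
  assumes E: "E \<in> sets (seq_space \<Otimes>\<^sub>M seq_space)"
    and unique: "\<And>x y y'. (x, y) \<in> E \<Longrightarrow> (x, y') \<in> E \<Longrightarrow> y = y'"
  shows "fst ` E \<in> sets seq_space"
proof -
  let ?j = "\<lambda>\<gamma> :: nat \<Rightarrow> nat \<times> nat. (fst \<circ> \<gamma>, snd \<circ> \<gamma>)"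
  have "(\<lambda>\<gamma>. f \<circ> \<gamma>) \<in> measurable (seq_space :: (nat \<Rightarrow> nat \<times> nat) measure) seq_space"
    for f :: "nat \<times> nat \<Rightarrow> nat"
    by (intro measurable_into_seq_space) (simp add: measurable_compose[OF measurable_seq_component])
  then have "?j \<in> measurable seq_space (seq_space \<Otimes>\<^sub>M seq_space)"
    by (intro measurable_Pair)
  from measurable_sets[OF this E] have "inj_projection (?j -` E)"
    by (simp add: inj_projection_of_sets)
  then obtain F :: "(nat \<Rightarrow> (nat \<times> nat) \<times> nat) set" where F: "seq_closed F"
      "inj_on (\<lambda>\<gamma>. fst \<circ> \<gamma>) F" "(\<lambda>\<gamma>. fst \<circ> \<gamma>) ` F = ?j -` E"
    unfolding inj_projection_def by blast
  have F_E: "((fst \<circ> fst) \<circ> \<gamma>, (snd \<circ> fst) \<circ> \<gamma>) \<in> E" if "\<gamma> \<in> F" for \<gamma>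
  proof -
    have "fst \<circ> \<gamma> \<in> ?j -` E" using F(3) that by blast
    then show ?thesis by (simp add: comp_assoc)
  qed
  have "inj_on (\<lambda>\<gamma>. (fst \<circ> fst) \<circ> \<gamma>) F"
  proof (rule inj_onI)
    fix \<gamma> \<delta> assume *: "\<gamma> \<in> F" "\<delta> \<in> F" "(fst \<circ> fst) \<circ> \<gamma> = (fst \<circ> fst) \<circ> \<delta>"
    have "(snd \<circ> fst) \<circ> \<gamma> = (snd \<circ> fst) \<circ> \<delta>"
      using unique F_E[OF *(1)] F_E[OF *(2)] *(3) by metis
    with *(3) have "fst \<circ> \<gamma> = fst \<circ> \<delta>" by (auto simp: fun_eq_iff prod_eq_iff)
    then show "\<gamma> = \<delta>" using inj_onD[OF F(2)] *(1,2) by blast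
  qed
  from lusin_souslin_seq[OF F(1) this]
  have "(\<lambda>\<gamma>. (fst \<circ> fst) \<circ> \<gamma>) ` F \<in> sets seq_space" .
  also have "(\<lambda>\<gamma>. (fst \<circ> fst) \<circ> \<gamma>) ` F = fst ` E"
  proof (intro equalityI subsetI)
    fix x assume "x \<in> (\<lambda>\<gamma>. (fst \<circ> fst) \<circ> \<gamma>) ` F"
    then obtain \<gamma> where \<gamma>: "\<gamma> \<in> F" "x = (fst \<circ> fst) \<circ> \<gamma>" by blast
    then show "x \<in> fst ` E" using F_E[of \<gamma>] by (intro rev_image_eqI[of _ E]) auto
  next
    fix x assume "x \<in> fst ` E"
    then obtain y where "(x, y) \<in> E" by auto
    then have "(\<lambda>n. (x n, y n)) \<in> ?j -` E" by (simp add: comp_def)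
    then have "(\<lambda>n. (x n, y n)) \<in> (\<lambda>\<gamma>. fst \<circ> \<gamma>) ` F" using F(3) by simp
    then obtain \<gamma> where "(\<lambda>n. (x n, y n)) = fst \<circ> \<gamma>" "\<gamma> \<in> F" by (rule imageE)
    then show "x \<in> (\<lambda>\<gamma>. (fst \<circ> fst) \<circ> \<gamma>) ` F"
      by (intro rev_image_eqI[of \<gamma>]) (auto simp: fun_eq_iff prod_eq_iff)
  qed
  finally show ?thesis .
qed

section \<open>Uniformization of relations with bounded sections\<close>

text \<open>The lexicographic order, a linear order on Baire space with Borel graph.\<close>

definition seq_less :: "(nat \<Rightarrow> nat) \<Rightarrow> (nat \<Rightarrow> nat) \<Rightarrow> bool" where
  "seq_less x y \<longleftrightarrow> (\<exists>n. (\<forall>i<n. x i = y i) \<and> x n < y n)"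

lemma seq_less_irrefl: "\<not> seq_less x x"
  by (simp add: seq_less_def)

lemma seq_less_trans:
  assumes "seq_less x y" "seq_less y z"
  shows "seq_less x z"
proof -
  obtain m where m: "\<forall>i<m. x i = y i" "x m < y m" using assms(1) by (auto simp: seq_less_def)
  obtain n where n: "\<forall>i<n. y i = z i" "y n < z n" using assms(2) by (auto simp: seq_less_def)
  have "(\<forall>i<min m n. x i = z i) \<and> x (min m n) < z (min m n)"
    using m n by (cases m n rule: linorder_cases) auto
  then show ?thesis unfolding seq_less_def by blast
qed

lemma seq_less_total:
  assumes "x \<noteq> y"
  shows "seq_less x y \<or> seq_less y x"
proof -
  have ex: "\<exists>n. x n \<noteq> y n" using assms by (simp add: fun_eq_iff)
  define n where "n = (LEAST n. x n \<noteq> y n)"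
  have "x n \<noteq> y n" unfolding n_def by (rule LeastI_ex[OF ex])
  moreover have "\<forall>i<n. x i = y i" using not_less_Least unfolding n_def by blast
  ultimately have "(\<forall>i<n. x i = y i) \<and> x n < y n \<or> (\<forall>i<n. y i = x i) \<and> y n < x n" by auto
  then show ?thesis unfolding seq_less_def by blast
qed

lemma measurable_seq_apply:
  assumes "f \<in> measurable N seq_space"
  shows "(\<lambda>p. f p i) \<in> measurable N (count_space UNIV)"
  using measurable_compose[OF assms measurable_seq_component] .

lemma measurable_seq_apply_pair:
  "(\<lambda>z. (fst z i, snd z i)) \<in> measurable
    ((seq_space :: (nat \<Rightarrow> nat) measure) \<Otimes>\<^sub>M (seq_space :: (nat \<Rightarrow> nat) measure)) (count_space UNIV)"
    (is "_ \<in> measurable ?N _")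
proof -
  have "(\<lambda>z. (fst z i, snd z i)) \<in> measurable ?N (count_space UNIV \<Otimes>\<^sub>M count_space UNIV)"
    by (intro measurable_Pair measurable_seq_apply measurable_fst measurable_snd)
  then show ?thesis by (simp add: pair_measure_countable)
qed

lemma seq_less_sets: "{(x, y). seq_less x y} \<in> sets (seq_space \<Otimes>\<^sub>M seq_space)"
proof -
  let ?N = "(seq_space :: (nat \<Rightarrow> nat) measure) \<Otimes>\<^sub>M (seq_space :: (nat \<Rightarrow> nat) measure)"
  have rel: "{z. Q (fst z i) (snd z i)} \<in> sets ?N" for Q :: "nat \<Rightarrow> nat \<Rightarrow> bool" and i
    using measurable_sets[OF measurable_seq_apply_pair[of i], of "{(a, b). Q a b}"]
    by (simp add: space_pair_measure vimage_def)
  have "(\<Union>n. (\<Inter>i. {z. i < n \<longrightarrow> fst z i = snd z i}) \<inter> {z. fst z n < snd z n}) \<in> sets ?N"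
  proof (intro sets.countable_UN'' sets.countable_INT'' sets.Int countableI_type)
    show "UNIV \<in> sets ?N"
      using rel[of "\<lambda>_ _. True"] by simp
    show "{z. i < n \<longrightarrow> fst z i = snd z i} \<in> sets ?N" for n i
      using rel[of "\<lambda>a b. i < n \<longrightarrow> a = b"] .
    show "{z. fst z n < snd z n} \<in> sets ?N" for n
      using rel[of "\<lambda>a b. a < b"] .
  qed
  also have "(\<Union>n. (\<Inter>i. {z. i < n \<longrightarrow> fst z i = snd z i}) \<inter> {z. fst z n < snd z n}) =
      {(x :: nat \<Rightarrow> nat, y). seq_less x y}"
    unfolding seq_less_def case_prod_beta by (rule set_eqI) simp
  finally show ?thesis .
qed

lemma finite_has_seq_max:
  assumes "finite S" "S \<noteq> {}"
  shows "\<exists>m\<in>S. \<forall>z\<in>S. \<not> seq_less m z"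
  using assms
proof (induction S rule: finite_ne_induct)
  case (singleton x)
  then show ?case by (simp add: seq_less_irrefl)
next
  case (insert a S)
  then obtain m where m: "m \<in> S" "\<And>z. z \<in> S \<Longrightarrow> \<not> seq_less m z" by blast
  show ?case
  proof (cases "seq_less m a")
    case True
    then have "\<not> seq_less a z" if "z \<in> S" for z using m(2)[OF that] seq_less_trans by blast
    then show ?thesis by (intro bexI[of _ a]) (auto simp: seq_less_irrefl)
  next
    case False
    then show ?thesis using m by (intro bexI[of _ m]) auto
  qed
qed

lemma measurable_pair_preimage:
  assumes "f \<in> measurable N A" "g \<in> measurable N B" "E \<in> sets (A \<Otimes>\<^sub>M B)"
  shows "{x \<in> space N. (f x, g x) \<in> E} \<in> sets N"
proof -
  have "(\<lambda>x. (f x, g x)) -` E \<inter> space N \<in> sets N"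
    by (rule measurable_sets[OF measurable_Pair[OF assms(1,2)] assms(3)])
  then show ?thesis by (simp add: vimage_def Int_def conj_commute)
qed

lemma mem_fst_image: "x \<in> fst ` Z \<longleftrightarrow> (\<exists>z. (x, z) \<in> Z)"
  by force

text \<open>Induction on the bound \<open>d\<close>. Let \<open>E1\<close> consist of the \<open>(x, y)\<close> in \<open>E\<close> such that \<open>y\<close> is not the largest
  element of its section. Relating a pair \<open>(x, y) \<in> E\<close> to the elements above \<open>y\<close> in
  the section of \<open>x\<close> gives sections of at most \<open>d - 1\<close> elements, so by induction the domain of this relation,
  which is \<open>E1\<close>, is Borel. The nonempty sections of \<open>E\<close> lose their largest element in \<open>E1\<close>, so \<open>E1\<close> is
  covered by induction as well. What remains of \<open>E\<close> is the graph of the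
  function that picks the largest element, which is Borel by \<open>domain_of_unique_sections\<close>. The point
  \<open>x\<close> itself serves as a default value, whence the insertions of \<open>x\<close> in the conclusion.\<close>

lemma bounded_sections_uniformization:
  fixes E :: "((nat \<Rightarrow> nat) \<times> (nat \<Rightarrow> nat)) set"
  assumes "E \<in> sets (seq_space \<Otimes>\<^sub>M seq_space)"
    and "\<And>x. finite (E `` {x}) \<and> card (E `` {x}) \<le> d"
  shows "\<exists>gs. set gs \<subseteq> measurable seq_space seq_space \<and>
    (\<forall>x. insert x (E `` {x}) = insert x ((\<lambda>g. g x) ` set gs))"
  using assms
proof (induction d arbitrary: E)
  case 0
  then have "E `` {x} = {}" for x by (metis card_0_eq le_zero_eq)
  then show ?case by (intro exI[of _ "[]"]) simp
next
  case (Suc d)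
  let ?S = "seq_space :: (nat \<Rightarrow> nat) measure"
  note E = Suc.prems(1)
  have fin: "finite (E `` {x})" "card (E `` {x}) \<le> Suc d" for x using Suc.prems(2) by blast+
  \<comment> \<open>the base of the auxiliary relation consists of pairs; they are coded as single sequences\<close>
  define l r where "l w i = fst (prod_decode (w i))" and "r w i = snd (prod_decode (w i))"
    for w :: "nat \<Rightarrow> nat" and i
  define p where "p x y i = prod_encode (x i, y i)" for x y :: "nat \<Rightarrow> nat" and i
  have lr: "l (p x y) = x" "r (p x y) = y" for x y by (simp_all add: l_def r_def p_def fun_eq_iff)
  have l: "l \<in> measurable ?S ?S" and r: "r \<in> measurable ?S ?S"
    unfolding l_def r_def
    by (intro measurable_into_seq_space measurable_compose[OF measurable_seq_component]; simp)+
  have p: "(\<lambda>z. p (fst z) (snd z)) \<in> measurable (?S \<Otimes>\<^sub>M ?S) ?S"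
  proof (rule measurable_into_seq_space)
    fix i
    from measurable_compose[OF measurable_seq_apply_pair, of prod_encode "count_space UNIV"]
    show "(\<lambda>z. p (fst z) (snd z) i) \<in> measurable (?S \<Otimes>\<^sub>M ?S) (count_space UNIV)"
      by (simp add: p_def)
  qed
  define E2 where "E2 = {q. (l (fst q), r (fst q)) \<in> E} \<inter> {q. (l (fst q), snd q) \<in> E} \<inter>
    {q. (r (fst q), snd q) \<in> {(x, y). seq_less x y}}"
  have E2_iff: "(w, z) \<in> E2 \<longleftrightarrow> (l w, r w) \<in> E \<and> (l w, z) \<in> E \<and> seq_less (r w) z" for w z
    by (simp add: E2_def)
  have lf: "(\<lambda>q. l (fst q)) \<in> measurable (?S \<Otimes>\<^sub>M ?S) ?S"
    and rf: "(\<lambda>q. r (fst q)) \<in> measurable (?S \<Otimes>\<^sub>M ?S) ?S"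
    using measurable_compose[OF measurable_fst l] measurable_compose[OF measurable_fst r] by auto
  have E2: "E2 \<in> sets (?S \<Otimes>\<^sub>M ?S)"
    using measurable_pair_preimage[OF lf rf E] measurable_pair_preimage[OF lf measurable_snd E]
      measurable_pair_preimage[OF rf measurable_snd seq_less_sets]
    unfolding E2_def by (auto simp: space_pair_measure)
  have "finite (E2 `` {w}) \<and> card (E2 `` {w}) \<le> d" for w
  proof (cases "(l w, r w) \<in> E")
    case True
    have "E2 `` {w} \<subseteq> E `` {l w} - {r w}" using seq_less_irrefl by (auto simp: E2_iff)
    moreover have "card (E `` {l w} - {r w}) \<le> d" using True fin[of "l w"] by simp
    ultimately show ?thesis
      using fin(1)[of "l w"] by (meson card_mono finite_Diff finite_subset le_trans)
  next
    case False
    then have "E2 `` {w} = {}" by (auto simp: E2_iff)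
    then show ?thesis by simp
  qed
  from Suc.IH[OF E2 this] obtain hs where hs: "set hs \<subseteq> measurable ?S ?S"
      "\<And>w. insert w (E2 `` {w}) = insert w ((\<lambda>g. g w) ` set hs)" by blast
  \<comment> \<open>the identity is included because the functions in \<open>hs\<close> cover the sections only up to the base point\<close>
  define E1 where "E1 = E \<inter> (\<Union>g\<in>set (id # hs). {q. (p (fst q) (snd q), g (p (fst q) (snd q))) \<in> E2})"
  have E1_iff: "(x, y) \<in> E1 \<longleftrightarrow> (x, y) \<in> E \<and> (\<exists>z. (x, z) \<in> E \<and> seq_less y z)" for x y
  proof -
    have "(\<exists>g\<in>set (id # hs). (w, g w) \<in> E2) \<longleftrightarrow> (\<exists>z. (w, z) \<in> E2)" for w
    proof
      assume "\<exists>z. (w, z) \<in> E2"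
      then obtain z where z: "(w, z) \<in> E2" by blast
      then have "z \<in> insert w ((\<lambda>g. g w) ` set hs)" using hs(2)[of w] by blast
      then show "\<exists>g\<in>set (id # hs). (w, g w) \<in> E2" using z by auto
    qed blast
    from this[of "p x y"] show ?thesis by (auto simp: E1_def E2_iff lr)
  qed
  have E1: "E1 \<in> sets (?S \<Otimes>\<^sub>M ?S)"
  proof -
    have "{q. (p (fst q) (snd q), g (p (fst q) (snd q))) \<in> E2} \<in> sets (?S \<Otimes>\<^sub>M ?S)"
      if "g \<in> set (id # hs)" for g
    proof -
      have "g \<in> measurable ?S ?S" using that hs(1) by (auto simp: id_def)
      from measurable_pair_preimage[OF p measurable_compose[OF p this] E2]
      show ?thesis by (simp add: space_pair_measure)
    qed
    then show ?thesis unfolding E1_def by (intro sets.Int E sets.finite_UN) simp_all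
  qed
  have max: "\<exists>m. (x, m) \<in> E \<and> (x, m) \<notin> E1" if "E `` {x} \<noteq> {}" for x
    using finite_has_seq_max[OF fin(1)[of x] that] by (auto simp: E1_iff)
  have "finite (E1 `` {x}) \<and> card (E1 `` {x}) \<le> d" for x
  proof (cases "E `` {x} = {}")
    case True
    then have "E1 `` {x} = {}" by (auto simp: E1_iff)
    then show ?thesis by simp
  next
    case False
    then obtain m where "(x, m) \<in> E" "(x, m) \<notin> E1" using max by blast
    then have "m \<in> E `` {x} - E1 `` {x}" by simp
    moreover have sub: "E1 `` {x} \<subseteq> E `` {x}" by (auto simp: E1_iff)
    ultimately have "E1 `` {x} \<subset> E `` {x}" by blast
    then have "card (E1 `` {x}) < card (E `` {x})" by (rule psubset_card_mono[OF fin(1)])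
    then show ?thesis using fin(2)[of x] finite_subset[OF sub fin(1)] by simp
  qed
  from Suc.IH[OF E1 this] obtain gs where gs: "set gs \<subseteq> measurable ?S ?S"
      "\<And>x. insert x (E1 `` {x}) = insert x ((\<lambda>g. g x) ` set gs)" by blast
  define E0 where "E0 = E - E1"
  have E0: "E0 \<in> sets (?S \<Otimes>\<^sub>M ?S)" unfolding E0_def using E E1 by (rule sets.Diff)
  have E0_unique: "y = y'" if "(x, y) \<in> E0" "(x, y') \<in> E0" for x y y'
    using that seq_less_total[of y y'] by (auto simp: E0_def E1_iff)
  define g where "g x = (if x \<in> fst ` E0 then THE y. (x, y) \<in> E0 else x)" for x
  have g_eq: "g x = y" if "(x, y) \<in> E0" for x y
  proof -
    have "x \<in> fst ` E0" using that by (intro image_eqI[of _ fst "(x, y)"]) simp_all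
    moreover have "(THE y. (x, y) \<in> E0) = y"
      by (rule the_equality[where P = "\<lambda>y. (x, y) \<in> E0", OF that]) (rule E0_unique[OF _ that])
    ultimately show ?thesis by (simp add: g_def)
  qed
  have "g \<in> measurable ?S ?S"
  proof (rule measurableI)
    fix A assume A: "A \<in> sets ?S"
    have "E0 \<inter> (UNIV \<times> A) \<in> sets (?S \<Otimes>\<^sub>M ?S)"
      by (intro sets.Int E0 pair_measureI A UNIV_in_sets_seq_space)
    then have "fst ` (E0 \<inter> (UNIV \<times> A)) \<in> sets ?S"
    proof (rule domain_of_unique_sections)
      show "y = y'" if "(x, y) \<in> E0 \<inter> (UNIV \<times> A)" "(x, y') \<in> E0 \<inter> (UNIV \<times> A)" for x y y'
        using that by (intro E0_unique[of x y y']) auto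
    qed
    moreover have "fst ` E0 \<in> sets ?S" by (rule domain_of_unique_sections[OF E0 E0_unique])
    moreover have "g -` A = fst ` (E0 \<inter> (UNIV \<times> A)) \<union> (A - fst ` E0)"
    proof (intro set_eqI)
      fix x
      show "x \<in> g -` A \<longleftrightarrow> x \<in> fst ` (E0 \<inter> (UNIV \<times> A)) \<union> (A - fst ` E0)"
      proof (cases "x \<in> fst ` E0")
        case True
        then obtain y where y: "(x, y) \<in> E0" unfolding mem_fst_image by blast
        have "x \<in> fst ` (E0 \<inter> (UNIV \<times> A)) \<longleftrightarrow> (\<exists>z. (x, z) \<in> E0 \<and> z \<in> A)"
          by (simp add: mem_fst_image)
        also have "\<dots> \<longleftrightarrow> y \<in> A" using y E0_unique[OF y] by blast
        finally have "x \<in> fst ` (E0 \<inter> (UNIV \<times> A)) \<longleftrightarrow> y \<in> A" .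
        then show ?thesis using True g_eq[OF y] by simp
      next
        case False
        then have "x \<notin> fst ` (E0 \<inter> (UNIV \<times> A))" by blast
        then show ?thesis using False by (simp add: g_def)
      qed
    qed
    ultimately show "g -` A \<inter> space ?S \<in> sets ?S" using A by simp
  qed simp
  moreover have "insert x (E `` {x}) = insert x ((\<lambda>g. g x) ` set (g # gs))" for x
  proof -
    have "insert x (E `` {x}) = insert x (E0 `` {x} \<union> E1 `` {x})" by (auto simp: E0_def E1_iff)
    also have "\<dots> = insert x (E0 `` {x}) \<union> insert x (E1 `` {x})" by blast
    also have "insert x (E0 `` {x}) = {x, g x}"
    proof (cases "x \<in> fst ` E0")
      case True
      then obtain y where y: "(x, y) \<in> E0" unfolding mem_fst_image by blast
      have "z = y" if "(x, z) \<in> E0" for z using that y by (rule E0_unique)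
      with y have "E0 `` {x} = {y}" by blast
      then show ?thesis using g_eq[OF y] by simp
    next
      case False
      then have "E0 `` {x} = {}" by (auto simp: mem_fst_image)
      then show ?thesis using False by (simp add: g_def)
    qed
    finally show ?thesis by (auto simp: gs(2))
  qed
  ultimately show ?case using gs(1) by (intro exI[of _ "g # gs"]) simp
qed

section \<open>Transfer to standard Borel spaces\<close>

text \<open>Fix a dense sequence \<open>q\<close> in a complete metric for the space. The sequence \<open>h x\<close> lists, for each \<open>n\<close>, the
  first index \<open>k\<close> such that \<open>q k\<close> has distance less than \<open>1/2^n\<close> from \<open>x\<close>, and \<open>z\<close> maps a sequence of indices
  to the limit of the corresponding points. Both are Borel, although \<open>h\<close> is in general
  not continuous.\<close>

lemma standard_borel_retract:
  assumes "standard_borel M" and "space M \<noteq> {}"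
  shows "\<exists>h z. h \<in> measurable M (seq_space :: (nat \<Rightarrow> nat) measure) \<and> z \<in> measurable seq_space M \<and>
    (\<forall>x\<in>space M. z (h x) = x)"
proof -
  obtain X where X: "completely_metrizable_space X" "separable_space X" "space M = topspace X"
      "sets M = sigma_sets (topspace X) {U. openin X U}"
    using assms(1) unfolding standard_borel_def by blast
  obtain S D where S: "Metric_space S D" "Metric_space.mcomplete S D" "X = Metric_space.mtopology S D"
    using X(1) unfolding completely_metrizable_space_def by blast
  interpret Metric_space S D by (rule S(1))
  have space: "space M = S" using X(3) S(3) by simp
  have top: "topspace X = S" using S(3) by simp
  have open_sets: "U \<in> sets M" if "openin mtopology U" for U
    using that unfolding X(4) S(3)[symmetric] by (intro sigma_sets.Basic) simp
  obtain C where C: "countable C" "C \<subseteq> S" "mtopology closure_of C = S"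
    using X(2) unfolding separable_space_def S(3) by auto
  obtain x0 where x0: "x0 \<in> S" using assms(2) space by blast
  have "C \<noteq> {}" using C(3) x0 by auto
  define q where "q = from_nat_into C"
  have q: "range q = C" using \<open>C \<noteq> {}\<close> C(1) by (simp add: q_def range_from_nat_into)
  have qS [simp]: "q k \<in> S" for k using q C(2) by blast
  have dense: "\<exists>k. D x (q k) < r" if "x \<in> S" "r > 0" for x r
  proof -
    have "x \<in> mtopology closure_of C" using C(3) that by simp
    then have "\<exists>y\<in>C. y \<in> mball x r" using that(2) unfolding metric_closure_of by blast
    then show ?thesis unfolding q[symmetric] by auto
  qed
  let ?e = "\<lambda>n. (1 / 2 :: real) ^ n"
  define h where "h x n = (LEAST k. D x (q k) < ?e n)" for x n
  have h: "D x (q (h x n)) < ?e n" if "x \<in> S" for x n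
    unfolding h_def by (rule LeastI_ex) (use dense[OF that] in simp)
  have h_meas: "h \<in> measurable M seq_space"
  proof (rule measurable_into_seq_space)
    fix n
    have "Measurable.pred M (\<lambda>x. D x (q k) < ?e n)" for k
    proof -
      have "{x \<in> space M. D x (q k) < ?e n} = mball (q k) (?e n)"
        by (auto simp: space in_mball commute)
      then show ?thesis unfolding pred_def using open_sets openin_mball by simp
    qed
    then show "(\<lambda>x. h x n) \<in> measurable M (count_space UNIV)"
      unfolding h_def by (rule measurable_Least)
  qed
  have small: "\<exists>n. 8 * ?e n < r" if "r > 0" for r :: real
    using real_arch_pow_inv[of "r / 8" "1 / 2"] that by (auto simp: field_simps)
  \<comment> \<open>consecutive points listed by \<open>h x\<close> are closer than \<open>1/2^n + 1/2^(n+1)\<close>; this forces convergence, at distance at most \<open>4/2^n\<close> from the \<open>n\<close>-th point\<close>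
  define good where "good a \<longleftrightarrow> (\<forall>n. D (q (a n)) (q (a (Suc n))) < 2 * ?e n)" for a
  define lim where "lim a =
    (if good a then SOME l. l \<in> S \<and> (\<forall>n. D l (q (a n)) \<le> 4 * ?e n) else x0)" for a
  have lim: "lim a \<in> S \<and> (\<forall>n. D (lim a) (q (a n)) \<le> 4 * ?e n)" if "good a" for a
  proof -
    have near: "D (q (a n)) (q (a (n + k))) \<le> 4 * ?e n - 4 * ?e (n + k)" for n k
    proof (induction k)
      case (Suc k)
      have "D (q (a n)) (q (a (n + Suc k))) \<le>
          D (q (a n)) (q (a (n + k))) + D (q (a (n + k))) (q (a (Suc (n + k))))"
        by (simp add: triangle)
      also have "\<dots> \<le> 4 * ?e n - 4 * ?e (n + k) + 2 * ?e (n + k)"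
        using Suc that unfolding good_def by (intro add_mono) (auto intro: less_imp_le)
      finally show ?case by simp
    qed simp
    have near': "D (q (a n)) (q (a m)) \<le> 4 * ?e n" if "n \<le> m" for n m
    proof -
      have "D (q (a n)) (q (a m)) \<le> 4 * ?e n - 4 * ?e m" using near[of n "m - n"] that by simp
      moreover have "0 \<le> ?e m" by simp
      ultimately show ?thesis by linarith
    qed
    have "MCauchy (\<lambda>n. q (a n))"
      unfolding MCauchy_def
    proof (intro conjI allI impI)
      show "range (\<lambda>n. q (a n)) \<subseteq> S" by auto
      fix r :: real assume "r > 0"
      then obtain N where N: "8 * ?e N < r" using small by blast
      have "D (q (a n)) (q (a m)) < r" if "N \<le> n" "N \<le> m" for n m
        using triangle''[of "q (a n)" "q (a N)" "q (a m)"] near'[OF that(1)] near'[OF that(2)] N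
        by simp
      then show "\<exists>N. \<forall>n m. N \<le> n \<longrightarrow> N \<le> m \<longrightarrow> D (q (a n)) (q (a m)) < r" by blast
    qed
    then obtain l where "limitin mtopology (\<lambda>n. q (a n)) l sequentially"
      using S(2) unfolding mcomplete_def by blast
    then have l: "l \<in> S" "\<And>r. r > 0 \<Longrightarrow> \<exists>N. \<forall>n\<ge>N. D (q (a n)) l < r"
      unfolding limit_metric_sequentially by auto
    have "D l (q (a n)) \<le> 4 * ?e n" for n
    proof (rule field_le_epsilon)
      fix r :: real assume "r > 0"
      then obtain N where N: "\<forall>n\<ge>N. D (q (a n)) l < r" using l(2) by blast
      have "D l (q (a n)) \<le> D l (q (a (max n N))) + D (q (a (max n N))) (q (a n))"
        using l(1) by (simp add: triangle)
      also have "\<dots> \<le> r + 4 * ?e n"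
        using N[rule_format, of "max n N"] near'[of n "max n N"]
        by (intro add_mono) (simp_all add: commute)
      finally show "D l (q (a n)) \<le> 4 * ?e n + r" by simp
    qed
    then have "\<exists>l. l \<in> S \<and> (\<forall>n. D l (q (a n)) \<le> 4 * ?e n)" using l(1) by blast
    from someI_ex[OF this] show ?thesis using that by (simp add: lim_def)
  qed
  have lim_h: "lim (h x) = x" if x: "x \<in> S" for x
  proof -
    have "D (q (h x n)) (q (h x (Suc n))) < 2 * ?e n" for n
    proof -
      have "D (q (h x n)) (q (h x (Suc n))) \<le> D x (q (h x n)) + D x (q (h x (Suc n)))"
        using triangle''[of "q (h x n)" x "q (h x (Suc n))"] x by simp
      also have "\<dots> < ?e n + ?e (Suc n)" using h[OF x] by (intro add_strict_mono)
      also have "\<dots> \<le> 2 * ?e n" by simp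
      finally show ?thesis .
    qed
    then have "good (h x)" by (simp add: good_def)
    note l = lim[OF this]
    have "\<not> D (lim (h x)) x > 0"
    proof
      assume "D (lim (h x)) x > 0"
      then obtain n where n: "8 * ?e n < D (lim (h x)) x" using small by blast
      have "D (lim (h x)) x \<le> D (lim (h x)) (q (h x n)) + D x (q (h x n))"
        using triangle'[of "lim (h x)" "q (h x n)" x] l x by simp
      also have "\<dots> \<le> 4 * ?e n + ?e n"
        using l h[OF x] by (intro add_mono) (auto intro: less_imp_le)
      also have "\<dots> \<le> 8 * ?e n" by simp
      finally show False using n by simp
    qed
    then show ?thesis using l x by (metis mdist_pos_less)
  qed
  have good_sets: "{a. good a} \<in> sets seq_space"
  proof -
    have "{a. D (q (a n)) (q (a (Suc n))) < 2 * ?e n} \<in> sets seq_space" for n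
    proof -
      have "{a. D (q (a n)) (q (a (Suc n))) < 2 * ?e n} =
          (\<Union>j. {a. a n \<in> {j}} \<inter> {a. a (Suc n) \<in> {k. D (q j) (q k) < 2 * ?e n}})"
        by auto
      also have "\<dots> \<in> sets seq_space"
        by (intro sets.countable_UN'' sets.Int seq_coordinate_sets countableI_type)
      finally show ?thesis .
    qed
    then have "(\<Inter>n. {a. D (q (a n)) (q (a (Suc n))) < 2 * ?e n}) \<in> sets seq_space"
      by (intro sets.countable_INT'') simp_all
    also have "(\<Inter>n. {a. D (q (a n)) (q (a (Suc n))) < 2 * ?e n}) = {a. good a}"
      by (auto simp: good_def)
    finally show ?thesis .
  qed
  have "lim \<in> measurable seq_space M"
  proof (rule measurable_sigma_sets[OF X(4)])
    show "{U. openin X U} \<subseteq> Pow (topspace X)" by (auto dest: openin_subset)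
    show "lim \<in> space seq_space \<rightarrow> topspace X"
      using lim x0 by (auto simp: top lim_def)
    fix U assume "U \<in> {U. openin X U}"
    then have U: "openin mtopology U" by (simp add: S(3))
    let ?B = "\<Union>n. {a. a n \<in> {k. mcball (q k) (4 * ?e n) \<subseteq> U}}"
    \<comment> \<open>whether the limit lies in an open set is decided by a single entry of the sequence\<close>
    have iff: "lim a \<in> U \<longleftrightarrow> a \<in> ?B" if "good a" for a
    proof
      assume "a \<in> ?B"
      then obtain n where "mcball (q (a n)) (4 * ?e n) \<subseteq> U" by blast
      moreover have "lim a \<in> mcball (q (a n)) (4 * ?e n)"
        using lim[OF that] by (simp add: commute)
      ultimately show "lim a \<in> U" by blast
    next
      assume "lim a \<in> U"
      then obtain r where r: "r > 0" "mball (lim a) r \<subseteq> U"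
        using U unfolding openin_mtopology by blast
      obtain n where n: "8 * ?e n < r" using small[OF r(1)] by blast
      have "mcball (q (a n)) (4 * ?e n) \<subseteq> mball (lim a) r"
      proof
        fix y assume "y \<in> mcball (q (a n)) (4 * ?e n)"
        then have y: "y \<in> S" "D (q (a n)) y \<le> 4 * ?e n" by auto
        have "D (lim a) y \<le> D (lim a) (q (a n)) + D (q (a n)) y"
          using lim[OF that] y by (simp add: triangle)
        also have "\<dots> \<le> 4 * ?e n + 4 * ?e n" using lim[OF that] y by (intro add_mono) auto
        finally show "y \<in> mball (lim a) r" using n lim[OF that] y by simp
      qed
      then show "a \<in> ?B" using r by blast
    qed
    have "lim -` U = ({a. good a} \<inter> ?B) \<union> (if x0 \<in> U then UNIV - {a. good a} else {})"
    proof (rule set_eqI)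
      fix a
      show "a \<in> lim -` U \<longleftrightarrow> a \<in> ({a. good a} \<inter> ?B) \<union> (if x0 \<in> U then UNIV - {a. good a} else {})"
        using iff[of a] by (cases "good a") (auto simp: lim_def)
    qed
    also have "\<dots> \<in> sets seq_space"
    proof -
      have "?B \<in> sets seq_space"
        by (intro sets.countable_UN'' seq_coordinate_sets countableI_type)
      then show ?thesis using good_sets by (cases "x0 \<in> U") (simp_all add: sets.Int sets.Un sets.Diff)
    qed
    finally show "lim -` U \<inter> space seq_space \<in> sets seq_space" by simp
  qed
  then show ?thesis using h_meas lim_h space by blast
qed

text \<open>The relation is transported along the embedding \<open>h\<close>, restricted to the Borel set \<open>R\<close> of codes, and
  the functions found on Baire space are transported back by the retraction.\<close>

lemma standard_borel_uniformization:
  assumes "standard_borel M" and E: "E \<in> sets (M \<Otimes>\<^sub>M M)"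
    and fin: "\<And>x. x \<in> space M \<Longrightarrow> finite (E `` {x}) \<and> card (E `` {x}) \<le> d"
  shows "\<exists>gs. set gs \<subseteq> measurable M M \<and>
    (\<forall>x\<in>space M. insert x (E `` {x}) = insert x ((\<lambda>g. g x) ` set gs))"
proof (cases "space M = {}")
  case True
  then show ?thesis by (intro exI[of _ "[]"]) simp
next
  case False
  let ?S = "seq_space :: (nat \<Rightarrow> nat) measure"
  obtain h z where h: "h \<in> measurable M ?S" and z: "z \<in> measurable ?S M"
    and zh: "\<And>x. x \<in> space M \<Longrightarrow> z (h x) = x"
    using standard_borel_retract[OF assms(1) False] by blast
  have E_space: "x \<in> space M \<and> y \<in> space M" if "(x, y) \<in> E" for x y
    using sets.sets_into_space[OF E] that by (auto simp: space_pair_measure)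
  have z_space: "z a \<in> space M" for a using measurable_space[OF z, of a] by simp
  define R where "R = {a. h (z a) = a}"
  have "R = (\<Inter>i. {a \<in> space ?S. h (z a) i = a i})" by (auto simp: R_def fun_eq_iff)
  also have "\<dots> \<in> sets ?S"
  proof (intro sets.countable_INT'' UNIV_in_sets_seq_space)
    fix i
    have "(\<lambda>a. (h (z a) i, a i)) \<in> measurable ?S (count_space UNIV \<Otimes>\<^sub>M count_space UNIV)"
      by (intro measurable_Pair measurable_seq_apply measurable_compose[OF z h] measurable_ident_sets) simp
    then have "(\<lambda>a. (h (z a) i, a i)) \<in> measurable ?S (count_space UNIV)"
      by (simp add: pair_measure_countable)
    from measurable_sets[OF this, of "{(j, k). j = k}"]
    show "{a \<in> space ?S. h (z a) i = a i} \<in> sets ?S" by (simp add: vimage_def)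
  qed simp
  finally have R: "R \<in> sets ?S" .
  define E' where "E' = (R \<times> R) \<inter> {p. (z (fst p), z (snd p)) \<in> E}"
  have "{p \<in> space (?S \<Otimes>\<^sub>M ?S). (z (fst p), z (snd p)) \<in> E} \<in> sets (?S \<Otimes>\<^sub>M ?S)"
    by (rule measurable_pair_preimage[OF measurable_compose[OF measurable_fst z]
          measurable_compose[OF measurable_snd z] E])
  then have E': "E' \<in> sets (?S \<Otimes>\<^sub>M ?S)"
    unfolding E'_def by (intro sets.Int pair_measureI R) (simp add: space_pair_measure)
  have "finite (E' `` {a}) \<and> card (E' `` {a}) \<le> d" for a
  proof -
    have "E' `` {a} \<subseteq> h ` (E `` {z a})"
    proof
      fix b assume "b \<in> E' `` {a}"
      then have "h (z b) = b" "z b \<in> E `` {z a}" by (auto simp: E'_def R_def)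
      then show "b \<in> h ` (E `` {z a})" by (metis imageI)
    qed
    then show ?thesis
      using fin[OF z_space[of a]] by (meson card_image_le card_mono finite_imageI finite_subset le_trans)
  qed
  from bounded_sections_uniformization[OF E' this] obtain gs where
    gs: "set gs \<subseteq> measurable ?S ?S"
      "\<And>a. insert a (E' `` {a}) = insert a ((\<lambda>g. g a) ` set gs)" by blast
  have "insert x (E `` {x}) = insert x ((\<lambda>g. g x) ` set (map (\<lambda>g x. z (g (h x))) gs))"
    if x: "x \<in> space M" for x
  proof -
    have "E `` {x} = z ` (E' `` {h x})"
    proof (intro equalityI subsetI)
      fix y assume "y \<in> E `` {x}"
      then have "h y \<in> E' `` {h x}" "z (h y) = y"
        using E_space[of x y] zh x by (auto simp: E'_def R_def)
      then show "y \<in> z ` (E' `` {h x})" by (metis imageI)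
    next
      fix y assume "y \<in> z ` (E' `` {h x})"
      then show "y \<in> E `` {x}" using zh[OF x] by (auto simp: E'_def)
    qed
    then have "insert x (E `` {x}) = z ` insert (h x) (E' `` {h x})" using zh[OF x] by simp
    also have "\<dots> = z ` insert (h x) ((\<lambda>g. g (h x)) ` set gs)" by (simp only: gs(2))
    finally show ?thesis using zh[OF x] by (simp add: image_image)
  qed
  moreover have "set (map (\<lambda>g x. z (g (h x))) gs) \<subseteq> measurable M M"
    using gs(1) by (auto intro!: measurable_compose[OF _ z] measurable_compose[OF h])
  ultimately show ?thesis by blast
qed

lemma standard_borel_separating_map:
  assumes "standard_borel M"
  obtains h where "h \<in> measurable M (seq_space :: (nat \<Rightarrow> nat) measure)" "inj_on h (space M)"
proof (cases "space M = {}")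
  case True
  show ?thesis
  proof (rule that)
    show "(\<lambda>_ _. 0) \<in> measurable M seq_space" by (simp add: measurable_into_seq_space)
  qed (simp add: True)
next
  case False
  then show ?thesis
    using standard_borel_retract[OF assms False] that by (metis inj_on_inverseI)
qed

section \<open>Balls and their isomorphisms\<close>

text \<open>The vertex set of the ball of radius \<open>r\<close> around \<open>x\<close>, in terms of walks, which is the form suited
  to induction.\<close>

definition nbhd :: "('a, 'b) graph_scheme \<Rightarrow> 'a \<Rightarrow> nat \<Rightarrow> 'a set" where
  "nbhd G x r = {y. \<exists>j\<le>r. (x, y) \<in> edges G ^^ j}"

lemma nbhd_0: "nbhd G x 0 = {x}"
  by (auto simp: nbhd_def)

lemma nbhd_Suc: "nbhd G x (Suc r) = nbhd G x r \<union> edges G `` nbhd G x r"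
proof (intro equalityI subsetI)
  fix y assume "y \<in> nbhd G x (Suc r)"
  then obtain j where j: "j \<le> Suc r" "(x, y) \<in> edges G ^^ j" by (auto simp: nbhd_def)
  show "y \<in> nbhd G x r \<union> edges G `` nbhd G x r"
  proof (cases "j = Suc r")
    case True
    then obtain z where "(x, z) \<in> edges G ^^ r" "(z, y) \<in> edges G" using j by auto
    then show ?thesis by (auto simp: nbhd_def)
  next
    case False
    then show ?thesis using j by (auto simp: nbhd_def intro!: exI[of _ j])
  qed
next
  fix y assume "y \<in> nbhd G x r \<union> edges G `` nbhd G x r"
  then show "y \<in> nbhd G x (Suc r)"
  proof
    assume "y \<in> edges G `` nbhd G x r"
    then obtain z j where "j \<le> r" "(x, z) \<in> edges G ^^ j" "(z, y) \<in> edges G"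
      by (auto simp: nbhd_def)
    then have "Suc j \<le> Suc r" "(x, y) \<in> edges G ^^ Suc j" by auto
    then show ?thesis unfolding nbhd_def by blast
  qed (auto simp: nbhd_def intro: le_SucI)
qed

lemma nbhd_refl: "x \<in> nbhd G x r"
  unfolding nbhd_def by (auto intro!: exI[of _ 0])

lemma nbhd_mono: "r \<le> s \<Longrightarrow> nbhd G x r \<subseteq> nbhd G x s"
  unfolding nbhd_def by (auto intro: order_trans)

lemma nbhd_trans:
  assumes "y \<in> nbhd G x r" "z \<in> nbhd G y s"
  shows "z \<in> nbhd G x (r + s)"
proof -
  obtain i j where "i \<le> r" "(x, y) \<in> edges G ^^ i" "j \<le> s" "(y, z) \<in> edges G ^^ j"
    using assms by (auto simp: nbhd_def)
  then have "i + j \<le> r + s" "(x, z) \<in> edges G ^^ (i + j)"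
    by (auto simp: relpow_add)
  then show ?thesis unfolding nbhd_def by blast
qed

lemma nbhd_sym:
  assumes "sym (edges G)" "y \<in> nbhd G x r"
  shows "x \<in> nbhd G y r"
proof -
  have "(y, x) \<in> edges G ^^ j" if "(x, y) \<in> edges G ^^ j" for j
    using that
  proof (induction j arbitrary: y)
    case (Suc j)
    then obtain z where "(x, z) \<in> edges G ^^ j" "(z, y) \<in> edges G" by auto
    then show ?case using Suc.IH assms(1) by (meson relpow_Suc_I2 symD)
  qed simp
  then show ?thesis using assms(2) unfolding nbhd_def by blast
qed

lemma nbhd_verts:
  assumes "lf_graph G" "x \<in> verts G"
  shows "nbhd G x r \<subseteq> verts G"
proof (induction r)
  case (Suc r)
  then show ?case using assms(1) unfolding nbhd_Suc lf_graph_def by blast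
qed (use assms in \<open>simp add: nbhd_0\<close>)

lemma finite_nbhd:
  assumes "lf_graph G" "x \<in> verts G"
  shows "finite (nbhd G x r)"
proof (induction r)
  case (Suc r)
  have "edges G `` nbhd G x r = (\<Union>y\<in>nbhd G x r. {z. (y, z) \<in> edges G})" by blast
  moreover have "finite {z. (y, z) \<in> edges G}" if "y \<in> nbhd G x r" for y
    using assms(1) nbhd_verts[OF assms] that unfolding lf_graph_def by blast
  ultimately show ?case using Suc by (simp add: nbhd_Suc)
qed (simp add: nbhd_0)

lemma graph_dist_le_iff: "graph_dist G x y \<le> enat r \<longleftrightarrow> y \<in> nbhd G x r"
proof
  assume le: "graph_dist G x y \<le> enat r"
  show "y \<in> nbhd G x r"
  proof (rule ccontr)
    assume "y \<notin> nbhd G x r"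
    then have "enat (Suc r) \<le> graph_dist G x y"
      unfolding graph_dist_def nbhd_def
      by (intro INF_greatest) (auto simp: not_less_eq_eq[symmetric])
    then have "enat (Suc r) \<le> enat r" using le by (rule order_trans)
    then show False by simp
  qed
next
  assume "y \<in> nbhd G x r"
  then obtain j where "j \<le> r" "(x, y) \<in> edges G ^^ j" by (auto simp: nbhd_def)
  then show "graph_dist G x y \<le> enat r"
    unfolding graph_dist_def by (intro INF_lower2[of j]) auto
qed

lemma sball_eq_induced:
  assumes "lf_graph G" "x \<in> verts G"
  shows "sball G x r = induced G (nbhd G x r)"
proof -
  have "{y \<in> verts G. graph_dist G x y \<le> enat r} = nbhd G x r"
    using nbhd_verts[OF assms] by (auto simp: graph_dist_le_iff)
  then show ?thesis by (simp add: sball_def)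
qed

lemma verts_sball:
  assumes "lf_graph G" "x \<in> verts G"
  shows "verts (sball G x r) = nbhd G x r"
  using nbhd_verts[OF assms, of r] by (auto simp: sball_eq_induced[OF assms] induced_def)

lemma structured_induced:
  assumes "structured_graph G"
  shows "structured_graph (induced G U)"
proof -
  have G: "edges G \<subseteq> verts G \<times> verts G" "sym (edges G)" "irrefl (edges G)"
      "\<And>x. x \<in> verts G \<Longrightarrow> finite {y. (x, y) \<in> edges G}" "dom (str_map G) \<subseteq> lists (verts G)"
    using assms by (auto simp: structured_graph_def lf_graph_def)
  have "finite {y. (x, y) \<in> edges G \<and> y \<in> U}" if "x \<in> verts G" for x
    using G(4)[OF that] by (rule rev_finite_subset) auto
  then have "lf_graph (induced G U)"
    using G(1-3) by (auto simp: lf_graph_def induced_def sym_def irrefl_def)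
  moreover have "dom (str_map (induced G U)) \<subseteq> lists (verts (induced G U))"
    using G(5) by (auto simp: induced_def)
  moreover have "\<exists>l. \<forall>xs\<in>dom (str_map (induced G U)). length xs \<le> l"
  proof -
    obtain l where "\<forall>xs\<in>dom (str_map G). length xs \<le> l"
      using assms unfolding structured_graph_def by blast
    then have "\<forall>xs\<in>dom (str_map (induced G U)). length xs \<le> l" by (simp add: induced_def)
    then show ?thesis by blast
  qed
  ultimately show ?thesis by (simp add: structured_graph_def)
qed

lemma structured_sball: "structured_graph G \<Longrightarrow> structured_graph (sball G x r)"
  unfolding sball_def by (rule structured_induced)

lemma induced_induced: "U \<subseteq> W \<Longrightarrow> induced (induced G W) U = induced G U"
  by (auto simp: induced_def restrict_map_def fun_eq_iff lists_eq_set)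

text \<open>An isomorphism also preserves that the structure map is undefined at a tuple.\<close>

lemma iso_str_map:
  assumes "sgraph_iso \<phi> G H" "structured_graph G" "set xs \<subseteq> verts G"
  shows "str_map H (map \<phi> xs) = str_map G xs"
proof (cases "map \<phi> xs \<in> dom (str_map H)")
  case True
  then obtain ys where ys: "ys \<in> dom (str_map G)" "map \<phi> xs = map \<phi> ys"
    unfolding sgraph_isoD(4)[OF assms(1)] by blast
  have "set ys \<subseteq> verts G" using assms(2) ys(1) by (auto simp: structured_graph_def)
  moreover have "inj_on \<phi> (verts G)" using sgraph_isoD(1)[OF assms(1)] by (rule bij_betw_imp_inj_on)
  ultimately have "xs = ys"
    using ys(2) assms(3) by (metis inj_on_map_eq_map inj_on_subset Un_least)
  then show ?thesis using sgraph_isoD(5)[OF assms(1) ys(1)] by simp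
next
  case False
  then have "xs \<notin> dom (str_map G)" unfolding sgraph_isoD(4)[OF assms(1)] by blast
  then show ?thesis using False by (simp add: domIff)
qed

lemma sgraph_iso_induced:
  assumes iso: "sgraph_iso \<phi> G H" and G: "structured_graph G" and U: "U \<subseteq> verts G"
  shows "sgraph_iso \<phi> (induced G U) (induced H (\<phi> ` U))"
proof -
  note I = sgraph_isoD[OF iso]
  have inj: "inj_on \<phi> (verts G)" using I(1) by (rule bij_betw_imp_inj_on)
  have img: "\<phi> ` U \<subseteq> verts H" using I(2) U by auto
  have lists: "map \<phi> xs \<in> lists (\<phi> ` U) \<longleftrightarrow> xs \<in> lists U" if "set xs \<subseteq> verts G" for xs
    using that U inj by (auto simp: lists_eq_set inj_on_image_mem_iff subset_eq)
  have dom: "set xs \<subseteq> verts G" if "xs \<in> dom (str_map G)" for xs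
    using G that by (auto simp: structured_graph_def)
  show ?thesis
    unfolding sgraph_iso_def
  proof (intro conjI ballI)
    show "bij_betw \<phi> (verts (induced G U)) (verts (induced H (\<phi> ` U)))"
      using inj_on_subset[OF inj U] U img by (simp add: induced_def bij_betw_def Int_absorb1)
    show "(x, y) \<in> edges (induced G U) \<longleftrightarrow> (\<phi> x, \<phi> y) \<in> edges (induced H (\<phi> ` U))"
      if "x \<in> verts (induced G U)" "y \<in> verts (induced G U)" for x y
      using that I(3)[of x y] by (simp add: induced_def)
    have "dom (str_map H) \<inter> lists (\<phi> ` U) = map \<phi> ` (dom (str_map G) \<inter> lists U)"
      unfolding I(4) using lists dom by (auto simp del: in_lists_conv_set)
    then show "dom (str_map (induced H (\<phi> ` U))) = map \<phi> ` dom (str_map (induced G U))"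
      by (simp add: induced_def)
    show "str_map (induced G U) xs = str_map (induced H (\<phi> ` U)) (map \<phi> xs)"
      if "xs \<in> dom (str_map (induced G U))" for xs
    proof -
      have "xs \<in> dom (str_map G)" "xs \<in> lists U" using that by (auto simp: induced_def)
      then show ?thesis
        using I(5)[of xs] lists[of xs] dom[of xs] by (simp add: induced_def del: in_lists_conv_set)
    qed
  qed
qed

lemma verts_add_fun [simp]: "verts (add_fun G f) = verts G"
  and edges_add_fun [simp]: "edges (add_fun G f) = edges G"
  by (simp_all add: add_fun_def add_struct_def)

lemma nbhd_add_fun [simp]: "nbhd (add_fun G f) = nbhd G"
  by (simp add: nbhd_def fun_eq_iff)

lemma on_singletons_restrict:
  "on_singletons ((\<lambda>x. Some (f x)) |` V) xs = (if \<exists>x\<in>V. xs = [x] then Some (f (hd xs)) else None)"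
  by (auto simp: on_singletons_def restrict_map_def split: list.splits)

lemma dom_on_singletons_restrict:
  "dom (on_singletons ((\<lambda>x. Some (f x)) |` V)) = (\<lambda>x. [x]) ` V"
  by (auto simp: on_singletons_restrict dom_def split: if_splits)

lemma str_map_add_fun:
  "str_map (add_fun G f) xs = (if xs \<in> dom (str_map G) \<union> (\<lambda>x. [x]) ` verts G
     then Some (to_nat (str_map G xs, on_singletons ((\<lambda>x. Some (f x)) |` verts G) xs)) else None)"
  by (simp add: add_fun_def add_struct_def dom_on_singletons_restrict)

lemma dom_str_map_add_fun: "dom (str_map (add_fun G f)) = dom (str_map G) \<union> (\<lambda>x. [x]) ` verts G"
  by (auto simp: str_map_add_fun dom_def split: if_splits)

lemma lf_graph_add_fun [simp]: "lf_graph (add_fun G f) \<longleftrightarrow> lf_graph G"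
  by (simp add: lf_graph_def)

lemma structured_add_fun:
  assumes "structured_graph G"
  shows "structured_graph (add_fun G f)"
proof -
  obtain l where l: "\<And>xs. xs \<in> dom (str_map G) \<Longrightarrow> length xs \<le> l"
    using assms unfolding structured_graph_def by blast
  have "length xs \<le> max l 1" if "xs \<in> dom (str_map (add_fun G f))" for xs
    using that unfolding dom_str_map_add_fun
  proof
    assume "xs \<in> dom (str_map G)"
    then show ?thesis using l by (simp add: le_max_iff_disj)
  qed auto
  then have "\<exists>l. \<forall>xs\<in>dom (str_map (add_fun G f)). length xs \<le> l" by blast
  moreover have "dom (str_map (add_fun G f)) \<subseteq> lists (verts (add_fun G f))"
    using assms unfolding structured_graph_def dom_str_map_add_fun by auto
  ultimately show ?thesis using assms unfolding structured_graph_def by simp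
qed

lemma induced_add_fun: "induced (add_fun G f) U = add_fun (induced G U) f"
proof -
  have "str_map (induced (add_fun G f) U) xs = str_map (add_fun (induced G U) f) xs" for xs
  proof (cases "xs \<in> lists U")
    case True
    then have "(\<exists>x\<in>verts G. xs = [x]) \<longleftrightarrow> (\<exists>x\<in>verts G \<inter> U. xs = [x])" by auto
    then show ?thesis
      using True by (auto simp: str_map_add_fun induced_def on_singletons_restrict)
  next
    case False
    then have "xs \<notin> (\<lambda>x. [x]) ` (verts G \<inter> U)" by auto
    then show ?thesis using False
      by (auto simp: str_map_add_fun induced_def restrict_map_def dom_def)
  qed
  then show ?thesis
    by (intro sgraph.equality) (auto simp: induced_def fun_eq_iff)
qed

lemma sball_add_fun:
  assumes "lf_graph G" "x \<in> verts G"
  shows "sball (add_fun G f) x r = add_fun (sball G x r) f"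
  using assms by (simp add: sball_eq_induced induced_add_fun)

lemma sgraph_iso_add_fun:
  assumes iso: "sgraph_iso \<phi> G H" and G: "structured_graph G"
    and fg: "\<And>x. x \<in> verts G \<Longrightarrow> f x = g (\<phi> x)"
  shows "sgraph_iso \<phi> (add_fun G f) (add_fun H g)"
proof -
  note I = sgraph_isoD[OF iso]
  have img: "\<phi> ` verts G = verts H" using I(1) by (simp add: bij_betw_def)
  have dom: "dom (str_map (add_fun H g)) = map \<phi> ` dom (str_map (add_fun G f))"
    unfolding dom_str_map_add_fun I(4) img[symmetric] by (auto simp: image_Un image_image)
  show ?thesis
    unfolding sgraph_iso_def
  proof (intro conjI ballI)
    show "str_map (add_fun G f) xs = str_map (add_fun H g) (map \<phi> xs)"
      if xs: "xs \<in> dom (str_map (add_fun G f))" for xs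
    proof -
      have set: "set xs \<subseteq> verts G"
        using xs structured_add_fun[OF G, of f] by (auto simp: structured_graph_def)
      have "(\<exists>x\<in>verts G. xs = [x]) \<longleftrightarrow> (\<exists>x\<in>verts H. map \<phi> xs = [x])"
        using set img by auto
      moreover have "f (hd xs) = g (hd (map \<phi> xs))" if "\<exists>x\<in>verts G. xs = [x]"
        using that fg by auto
      ultimately have "on_singletons ((\<lambda>x. Some (f x)) |` verts G) xs =
          on_singletons ((\<lambda>x. Some (g x)) |` verts H) (map \<phi> xs)"
        unfolding on_singletons_restrict by simp
      moreover have "map \<phi> xs \<in> dom (str_map (add_fun H g))" using xs dom by blast
      ultimately show ?thesis
        using xs iso_str_map[OF iso G set]
        by (simp add: str_map_add_fun dom_str_map_add_fun del: Un_iff)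
    qed
  qed (use I(1,3) dom in simp_all)
qed

text \<open>A walk that starts at distance at most \<open>s\<close> from the centre and has at most \<open>R - s\<close> steps stays within the ball,
  so an isomorphism of balls maps it to a walk.\<close>

lemma relpow_image_under_sball_iso:
  assumes G: "lf_graph G" "x \<in> verts G" and H: "lf_graph H" "y \<in> verts H"
    and iso: "sgraph_iso \<phi> (sball G x R) (sball H y R)"
    and u: "u \<in> nbhd G x s" and path: "(u, v) \<in> edges G ^^ j" and le: "s + j \<le> R"
  shows "(\<phi> u, \<phi> v) \<in> edges H ^^ j"
  using path le
proof (induction j arbitrary: v)
  case (Suc j)
  then obtain w where w: "(u, w) \<in> edges G ^^ j" "(w, v) \<in> edges G" by auto
  have "w \<in> nbhd G u j" "v \<in> nbhd G u (Suc j)"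
    using w Suc.prems(1) unfolding nbhd_def by blast+
  then have "w \<in> nbhd G x R" "v \<in> nbhd G x R"
    using nbhd_trans[OF u, of w j] nbhd_trans[OF u, of v "Suc j"] Suc.prems(2)
      nbhd_mono[of "s + j" R G x] nbhd_mono[of "s + Suc j" R G x] by auto
  then have "w \<in> verts (sball G x R)" "v \<in> verts (sball G x R)" "(w, v) \<in> edges (sball G x R)"
    using w(2) by (simp_all add: verts_sball[OF G]) (simp add: sball_eq_induced[OF G] induced_def)
  then have "(\<phi> w, \<phi> v) \<in> edges (sball H y R)" using sgraph_isoD(3)[OF iso] by blast
  then have "(\<phi> w, \<phi> v) \<in> edges H" by (simp add: sball_def induced_def)
  then show ?case using Suc.IH[OF w(1)] Suc.prems(2) by auto
qed simp

lemma nbhd_image_under_sball_iso: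
  assumes G: "lf_graph G" "x \<in> verts G" and H: "lf_graph H" "y \<in> verts H"
    and iso: "sgraph_iso \<phi> (sball G x R) (sball H y R)"
    and u: "u \<in> nbhd G x s" and le: "s + r \<le> R"
  shows "\<phi> ` nbhd G u r \<subseteq> nbhd H (\<phi> u) r"
proof
  fix v' assume "v' \<in> \<phi> ` nbhd G u r"
  then obtain v j where v: "v' = \<phi> v" "j \<le> r" "(u, v) \<in> edges G ^^ j"
    by (auto simp: nbhd_def)
  then have "(\<phi> u, \<phi> v) \<in> edges H ^^ j"
    using relpow_image_under_sball_iso[OF G H iso u v(3)] le by simp
  then show "v' \<in> nbhd H (\<phi> u) r" using v by (auto simp: nbhd_def)
qed

text \<open>An isomorphism of balls of radius \<open>R\<close> preserves the balls of radius \<open>r\<close> around vertices at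
  distance at most \<open>R - r\<close> from the centre: these smaller balls are induced subgraphs of the larger ones, and
  \<open>nbhd_image_under_sball_iso\<close>, applied in both directions, identifies their vertex sets.\<close>

lemma sball_iso_restrict:
  assumes G: "structured_graph G" "x \<in> verts G" and H: "structured_graph H" "y \<in> verts H"
    and iso: "sgraph_iso \<phi> (sball G x R) (sball H y R)" and root: "\<phi> x = y"
    and u: "u \<in> nbhd G x s" and le: "s + r \<le> R"
  shows "sgraph_iso \<phi> (sball G u r) (sball H (\<phi> u) r)"
proof -
  have lf: "lf_graph G" "lf_graph H" using G(1) H(1) by (simp_all add: structured_graph_def)
  note iso' = sgraph_iso_inv[OF iso structured_sball[OF G(1)]]
  define \<psi> where "\<psi> = inv_into (verts (sball G x R)) \<phi>"
  note bij = sgraph_isoD(1)[OF iso]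
  have \<psi>\<phi>: "\<psi> (\<phi> v) = v" if "v \<in> nbhd G x R" for v
    using bij_betw_inv_into_left[OF bij] that by (simp add: \<psi>_def verts_sball[OF lf(1) G(2)])
  have \<phi>\<psi>: "\<phi> (\<psi> v) = v" if "v \<in> nbhd H y R" for v
    using bij_betw_inv_into_right[OF bij] that by (simp add: \<psi>_def verts_sball[OF lf(2) H(2)])
  have uR: "u \<in> nbhd G x R" using u nbhd_mono[of s R G x] le by auto
  have \<phi>u: "\<phi> u \<in> nbhd H y s"
    using nbhd_image_under_sball_iso[OF lf(1) G(2) lf(2) H(2) iso nbhd_refl[of x G 0], of s]
      u le root by auto
  have sub: "\<phi> ` nbhd G u r \<subseteq> nbhd H (\<phi> u) r"
    by (rule nbhd_image_under_sball_iso[OF lf(1) G(2) lf(2) H(2) iso u le])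
  have sub': "\<psi> ` nbhd H (\<phi> u) r \<subseteq> nbhd G u r"
    using nbhd_image_under_sball_iso[OF lf(2) H(2) lf(1) G(2) iso' \<phi>u le] \<psi>\<phi>[OF uR]
    by (simp add: \<psi>_def)
  have GR: "nbhd G u r \<subseteq> nbhd G x R" and HR: "nbhd H (\<phi> u) r \<subseteq> nbhd H y R"
    using nbhd_trans[OF u, of _ r] nbhd_trans[OF \<phi>u, of _ r] nbhd_mono[OF le, of G x]
      nbhd_mono[OF le, of H y] by auto
  have eq: "nbhd H (\<phi> u) r = \<phi> ` nbhd G u r"
  proof
    show "nbhd H (\<phi> u) r \<subseteq> \<phi> ` nbhd G u r"
    proof
      fix v assume v: "v \<in> nbhd H (\<phi> u) r"
      then have "\<psi> v \<in> nbhd G u r" using sub' by blast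
      moreover have "v = \<phi> (\<psi> v)" using \<phi>\<psi>[of v] HR v by auto
      ultimately show "v \<in> \<phi> ` nbhd G u r" by (rule rev_image_eqI)
    qed
  qed (rule sub)
  have "u \<in> verts G" "\<phi> u \<in> verts H"
    using uR nbhd_verts[OF lf(1) G(2)] \<phi>u nbhd_verts[OF lf(2) H(2)] by blast+
  then have "sball G u r = induced (sball G x R) (nbhd G u r)"
      "sball H (\<phi> u) r = induced (sball H y R) (nbhd H (\<phi> u) r)"
    using GR HR lf G(2) H(2) by (simp_all add: sball_eq_induced induced_induced)
  then show ?thesis
    using sgraph_iso_induced[OF iso structured_sball[OF G(1)], of "nbhd G u r"] GR eq
    by (simp add: verts_sball[OF lf(1) G(2)])
qed

lemma local_output_eqI:
  assumes "structured_graph G" "x \<in> verts G" "structured_graph H" "y \<in> verts H"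
    and "sgraph_iso \<phi> (sball G x r) (sball H y r)" "\<phi> x = y"
  shows "local_output A G r x = local_output A H r y"
proof -
  have lf: "lf_graph G" "lf_graph H" using assms(1,3) by (simp_all add: structured_graph_def)
  have "rooted_class (sball G x r) x = rooted_class (sball H y r) y"
    using assms lf rooted_class_eq_iff[OF structured_sball[OF assms(1)], of x r x "sball H y r" y]
    by (auto simp: verts_sball finite_nbhd nbhd_refl structured_sball)
  then show ?thesis by (simp add: local_output_def)
qed

text \<open>Here \<open>A\<close> is run for \<open>T\<close> rounds and then the verifier \<open>P\<close> inspects the result within radius \<open>t\<close>. The
  verifier sees only outputs at vertices at distance at most \<open>t\<close>, and these depend only on the ball
  of radius \<open>T + t\<close>.\<close>

lemma local_output_transfer:
  assumes G: "structured_graph G" "x \<in> verts G" and H: "structured_graph H" "y \<in> verts H"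
    and iso: "sgraph_iso \<phi> (sball G x (T + t)) (sball H y (T + t))" and root: "\<phi> x = y"
    and ids: "\<And>u. u \<in> nbhd G x (T + t) \<Longrightarrow> c u = ids (\<phi> u)"
  shows "local_output P (add_fun G (local_output A (add_fun G c) T)) t x =
    local_output P (add_fun H (local_output A (add_fun H ids) T)) t y"
proof -
  have lf: "lf_graph G" "lf_graph H" using G(1) H(1) by (simp_all add: structured_graph_def)
  let ?f = "local_output A (add_fun G c) T" and ?g = "local_output A (add_fun H ids) T"
  have iso_c: "sgraph_iso \<phi> (sball (add_fun G c) x (T + t)) (sball (add_fun H ids) y (T + t))"
    unfolding sball_add_fun[OF lf(1) G(2)] sball_add_fun[OF lf(2) H(2)]
    using ids by (intro sgraph_iso_add_fun iso structured_sball G) (simp add: verts_sball lf G)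
  have img: "\<phi> ` nbhd G x t \<subseteq> nbhd H y t"
    using nbhd_image_under_sball_iso[OF lf(1) G(2) lf(2) H(2) iso nbhd_refl[of x G 0], of t] root
    by simp
  have "?f u = ?g (\<phi> u)" if u: "u \<in> nbhd G x t" for u
  proof -
    have V: "u \<in> verts G" "\<phi> u \<in> verts H"
      using u img nbhd_verts[OF lf(1) G(2)] nbhd_verts[OF lf(2) H(2)] by blast+
    have "sgraph_iso \<phi> (sball (add_fun G c) u T) (sball (add_fun H ids) (\<phi> u) T)"
      using G H u
      by (intro sball_iso_restrict[OF _ _ _ _ iso_c root, where s = t] structured_add_fun) simp_all
    then show ?thesis
      using V by (intro local_output_eqI[where \<phi> = \<phi>] structured_add_fun G(1) H(1)) simp_all
  qed
  moreover have "sgraph_iso \<phi> (sball G x t) (sball H y t)"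
    using sball_iso_restrict[OF G H iso root nbhd_refl[of x G 0], of t] root by simp
  ultimately have "sgraph_iso \<phi> (sball (add_fun G ?f) x t) (sball (add_fun H ?g) y t)"
    unfolding sball_add_fun[OF lf(1) G(2)] sball_add_fun[OF lf(2) H(2)]
    by (intro sgraph_iso_add_fun structured_sball G) (simp_all add: verts_sball lf G)
  then show ?thesis
    using G(2) H(2) root
    by (intro local_output_eqI[where \<phi> = \<phi>] structured_add_fun G(1) H(1)) simp_all
qed

lemma inj_extends_to_bij:
  assumes "finite V" "card V = n" "U \<subseteq> V" "inj_on c U" "c ` U \<subseteq> {1..n}"
  obtains ids where "bij_betw ids V {1..n :: nat}" "\<And>u. u \<in> U \<Longrightarrow> ids u = c u"
proof -
  have fin: "finite U" using assms(1,3) finite_subset by blast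
  have "card (V - U) = card ({1..n} - c ` U)"
    using assms fin by (simp add: card_Diff_subset card_image)
  then obtain b where b: "bij_betw b (V - U) ({1..n} - c ` U)"
    using assms(1) finite_same_card_bij[of "V - U" "{1..n} - c ` U"] by auto
  define ids where "ids v = (if v \<in> U then c v else b v)" for v
  have "bij_betw ids U (c ` U)"
    using assms(4) by (intro bij_betw_imageI) (auto simp: ids_def inj_on_def)
  moreover have "bij_betw ids (V - U) ({1..n} - c ` U)"
    using b by (subst bij_betw_cong[of _ _ b]) (auto simp: ids_def)
  ultimately have "bij_betw ids (U \<union> (V - U)) (c ` U \<union> ({1..n} - c ` U))"
    by (rule bij_betw_combine) auto
  moreover have "U \<union> (V - U) = V" "c ` U \<union> ({1..n} - c ` U) = {1..n}"
    using assms(3,5) by auto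
  ultimately show ?thesis using that by (simp add: ids_def)
qed

text \<open>Two vertices of a ball of radius \<open>T + t\<close> have distance at most \<open>2 (T + t)\<close>, so \<open>c\<close> is injective on the
  ball and, on the isomorphic ball of a member \<open>H\<close> of the class, extends to a legitimate assignment
  of identifiers. The output on \<open>G\<close> near \<open>x\<close> then agrees with a correct output on \<open>H\<close>.\<close>

lemma local_algorithm_on_proper_coloring:
  fixes G :: "'a sgraph"
  assumes G: "structured_graph G" and loc: "locally_in G (T + t) n \<G>"
    and A: "\<And>(H :: nat sgraph) ids. structured_graph H \<Longrightarrow> finite (verts H) \<Longrightarrow>
      card (verts H) = n \<Longrightarrow> iso_class H \<in> \<G> \<Longrightarrow> bij_betw ids (verts H) {1..n} \<Longrightarrow>
      is_coloring (t, P) H (local_output A (add_fun H ids) T)"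
    and c: "c ` verts G \<subseteq> {1..n}"
    and proper: "\<And>u v. u \<in> verts G \<Longrightarrow> v \<in> nbhd G u (2 * (T + t)) \<Longrightarrow> u \<noteq> v \<Longrightarrow> c u \<noteq> c v"
  shows "is_coloring (t, P) G (local_output A (add_fun G c) T)"
  unfolding is_coloring_def
proof
  fix x assume x: "x \<in> verts G"
  have lf: "lf_graph G" using G by (simp add: structured_graph_def)
  let ?R = "T + t"
  obtain H :: "nat sgraph" and y where H: "structured_graph H" "finite (verts H)"
      "card (verts H) = n" "iso_class H \<in> \<G>" "y \<in> verts H"
      and cls: "rooted_class (sball G x ?R) x = rooted_class (sball H y ?R) y"
    using loc x unfolding locally_in_def by blast
  have lfH: "lf_graph H" using H(1) by (simp add: structured_graph_def)
  obtain \<phi> where \<phi>: "sgraph_iso \<phi> (sball G x ?R) (sball H y ?R)" "\<phi> x = y"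
    using cls rooted_class_eq_iff[OF structured_sball[OF G, of x ?R] _ _
        structured_sball[OF H(1), of y ?R], of x y]
    by (auto simp: verts_sball lf lfH x H(5) finite_nbhd nbhd_refl)
  let ?U = "nbhd G x ?R" and ?W = "nbhd H y ?R"
  have bij: "bij_betw \<phi> ?U ?W"
    using sgraph_isoD(1)[OF \<phi>(1)] by (simp add: verts_sball lf lfH x H(5))
  define \<psi> where "\<psi> = inv_into ?U \<phi>"
  have UV: "?U \<subseteq> verts G" by (rule nbhd_verts[OF lf x])
  have "inj_on c ?U"
  proof (rule inj_onI, rule ccontr)
    fix u v assume uv: "u \<in> ?U" "v \<in> ?U" "c u = c v" "u \<noteq> v"
    have "sym (edges G)" using lf by (simp add: lf_graph_def)
    then have "x \<in> nbhd G u ?R" using uv(1) by (rule nbhd_sym)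
    from nbhd_trans[OF this uv(2)] have "v \<in> nbhd G u (2 * ?R)" by (simp only: mult_2)
    moreover have "u \<in> verts G" using uv(1) UV by blast
    ultimately have "c u \<noteq> c v" using uv(4) by (intro proper)
    then show False using uv(3) by contradiction
  qed
  then have "inj_on (c \<circ> \<psi>) ?W"
    using bij_betw_inv_into[OF bij] unfolding \<psi>_def
    by (intro comp_inj_on) (auto simp: bij_betw_def)
  moreover have "(c \<circ> \<psi>) ` ?W \<subseteq> {1..n}"
  proof -
    have "\<psi> ` ?W = ?U"
      using bij_betw_inv_into[OF bij] unfolding \<psi>_def by (rule bij_betw_imp_surj_on)
    then have "(c \<circ> \<psi>) ` ?W = c ` ?U" by (simp only: image_comp[symmetric])
    then show ?thesis using c UV by blast
  qed
  ultimately obtain ids where ids: "bij_betw ids (verts H) {1..n}"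
      "\<And>w. w \<in> ?W \<Longrightarrow> ids w = (c \<circ> \<psi>) w"
    using inj_extends_to_bij[OF H(2,3) nbhd_verts[OF lfH H(5)], of "c \<circ> \<psi>"] by blast
  have "c u = ids (\<phi> u)" if "u \<in> ?U" for u
  proof -
    have "\<phi> u \<in> ?W" using bij that by (auto simp: bij_betw_def)
    then show ?thesis using ids(2) bij_betw_inv_into_left[OF bij that] by (simp add: \<psi>_def)
  qed
  then have "local_output P (add_fun G (local_output A (add_fun G c) T)) t x =
    local_output P (add_fun H (local_output A (add_fun H ids) T)) t y"
    by (rule local_output_transfer[OF G x H(1,5) \<phi>])
  also have "\<dots> = 1"
    using A[OF H(1-4) ids(1)] H(5) by (simp add: is_coloring_def)
  finally show "local_output (snd (t, P)) (add_fun G (local_output A (add_fun G c) T)) (fst (t, P)) x = 1"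
    by simp
qed

section \<open>Borel colourings of powers of bounded degree Borel graphs\<close>

lemma nbhd_enumeration:
  assumes G: "borel_graph M G"
    and deg: "\<And>x. x \<in> verts G \<Longrightarrow> card (edges G `` {x}) \<le> d"
  shows "\<exists>ws. set ws \<subseteq> measurable M M \<and> (\<forall>x\<in>space M. nbhd G x r = (\<lambda>w. w x) ` set ws)"
proof (induction r)
  case 0
  show ?case by (intro exI[of _ "[\<lambda>x. x]"]) (simp add: nbhd_0)
next
  case (Suc r)
  have V: "verts G = space M" and lf: "lf_graph G" and sb: "standard_borel M"
    and E: "edges G \<in> sets (M \<Otimes>\<^sub>M M)"
    using G by (auto simp: borel_graph_def)
  have "finite (edges G `` {x}) \<and> card (edges G `` {x}) \<le> d" if "x \<in> space M" for x
  proof -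
    have "edges G `` {x} = {y. (x, y) \<in> edges G}" by auto
    then show ?thesis using lf deg[of x] that V by (simp add: lf_graph_def)
  qed
  from standard_borel_uniformization[OF sb E this] obtain gs where gs: "set gs \<subseteq> measurable M M"
      "\<And>x. x \<in> space M \<Longrightarrow> insert x (edges G `` {x}) = insert x ((\<lambda>g. g x) ` set gs)" by blast
  from Suc obtain ws where ws: "set ws \<subseteq> measurable M M"
      "\<And>x. x \<in> space M \<Longrightarrow> nbhd G x r = (\<lambda>w. w x) ` set ws" by blast
  define ws' where "ws' = ws @ concat (map (\<lambda>g. map (\<lambda>w x. g (w x)) ws) gs)"
  have set_ws': "set ws' = set ws \<union> (\<Union>g\<in>set gs. (\<lambda>w x. g (w x)) ` set ws)"
    by (simp add: ws'_def)
  have "(\<lambda>x. g (w x)) \<in> measurable M M" if "g \<in> set gs" "w \<in> set ws" for g w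
    using measurable_compose[OF subsetD[OF ws(1) that(2)] subsetD[OF gs(1) that(1)]] .
  then have "set ws' \<subseteq> measurable M M"
    unfolding set_ws' using ws(1) by (intro Un_least UN_least image_subsetI)
  moreover have "nbhd G x (Suc r) = (\<lambda>w. w x) ` set ws'" if x: "x \<in> space M" for x
  proof -
    have sub: "nbhd G x r \<subseteq> space M" using nbhd_verts[OF lf] x V by simp
    have "nbhd G x (Suc r) = (\<Union>y\<in>nbhd G x r. insert y (edges G `` {y}))"
      by (auto simp: nbhd_Suc)
    also have "\<dots> = (\<Union>y\<in>nbhd G x r. insert y ((\<lambda>g. g y) ` set gs))"
      using gs(2) sub by (intro SUP_cong) auto
    also have "\<dots> = nbhd G x r \<union> (\<Union>g\<in>set gs. g ` nbhd G x r)" by auto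
    also have "\<dots> = (\<lambda>w. w x) ` set ws'"
      by (simp add: ws(2)[OF x] set_ws' image_Un image_UN image_image)
    finally show ?thesis .
  qed
  ultimately show ?case by blast
qed

lemma measurable_map_list:
  fixes f :: "'i \<Rightarrow> 'a \<Rightarrow> 'b::countable"
  assumes "\<And>i. i \<in> set js \<Longrightarrow> f i \<in> measurable M (count_space UNIV)"
  shows "(\<lambda>x. map (\<lambda>i. f i x) js) \<in> measurable M (count_space UNIV)"
  using assms
proof (induction js)
  case (Cons i js)
  have 1: "(\<lambda>x. map (\<lambda>i. f i x) js) \<in> measurable M (count_space UNIV)"
    using Cons by simp
  have "(\<lambda>x. f i x # map (\<lambda>i. f i x) js) \<in> measurable M (count_space UNIV)"
  proof (rule measurable_compose_countable[where f = "\<lambda>b x. b # map (\<lambda>i. f i x) js" and g = "f i"])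
    show "(\<lambda>x. b # map (\<lambda>i. f i x) js) \<in> measurable M (count_space UNIV)" for b
      by (rule measurable_compose[OF 1]) simp
    show "f i \<in> measurable M (count_space UNIV)" using Cons.prems by simp
  qed
  then show ?case by simp
qed simp

text \<open>The values of the functions in \<open>K\<close>, listed, form a measurable map into a countable set, and
  \<open>F\<close> factors through it.\<close>

lemma measurable_finitely_determined:
  fixes K :: "('a \<Rightarrow> 'b::countable) set"
  assumes "finite K" "K \<subseteq> measurable M (count_space UNIV)"
    and det: "\<And>x y. x \<in> space M \<Longrightarrow> y \<in> space M \<Longrightarrow> (\<And>k. k \<in> K \<Longrightarrow> k x = k y) \<Longrightarrow> F x = F y"
  shows "F \<in> measurable M (count_space UNIV)"
proof (rule measurableI)
  fix A
  obtain ks where ks: "set ks = K" using finite_list[OF assms(1)] by blast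
  define key where "key x = map (\<lambda>k. k x) ks" for x
  have key: "key \<in> measurable M (count_space UNIV)"
    unfolding key_def using assms(2) ks by (intro measurable_map_list) auto
  have key_F: "F x = F y" if "x \<in> space M" "y \<in> space M" "key x = key y" for x y
  proof (rule det[OF that(1,2)])
    show "k x = k y" if "k \<in> K" for k
      using that \<open>key x = key y\<close> ks by (simp add: key_def)
  qed
  have "F -` A \<inter> space M = key -` (key ` (F -` A \<inter> space M)) \<inter> space M"
  proof (intro equalityI subsetI)
    fix x assume "x \<in> key -` (key ` (F -` A \<inter> space M)) \<inter> space M"
    then obtain y where "key x = key y" "F y \<in> A" "y \<in> space M" "x \<in> space M" by auto
    then show "x \<in> F -` A \<inter> space M" using key_F[of x y] by simp
  qed auto
  also have "\<dots> \<in> sets M" by (rule measurable_sets[OF key]) simp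
  finally show "F -` A \<inter> space M \<in> sets M" .
qed simp

text \<open>Embed the space into Baire space by \<open>h\<close>. The colour of \<open>x\<close> is the shortest initial segment of \<open>h x\<close>
  that tells \<open>x\<close> apart from all its finitely many neighbours \<open>w x\<close>. Neighbours of the same colour
  would have the same segment of the same length, against the choice of this segment.\<close>

lemma countable_proper_coloring:
  assumes sb: "standard_borel M" and ws: "set ws \<subseteq> measurable M M"
  shows "\<exists>c :: 'a \<Rightarrow> nat. c \<in> measurable M (count_space UNIV) \<and>
    (\<forall>x\<in>space M. \<forall>w\<in>set ws. w x \<noteq> x \<longrightarrow> c (w x) \<noteq> c x)"
proof -
  obtain h where h: "h \<in> measurable M (seq_space :: (nat \<Rightarrow> nat) measure)" "inj_on h (space M)"
    using standard_borel_separating_map[OF sb] by blast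
  define P where "P m x \<longleftrightarrow>
    (\<forall>w\<in>set ws. (\<forall>i. h (w x) i = h x i) \<or> (\<exists>i<m. h (w x) i \<noteq> h x i))" for m x
  define m where "m x = (LEAST m. P m x)" for x
  have P_m: "P (m x) x" for x
  proof -
    have "\<forall>\<^sub>F m in sequentially. (\<forall>i. h (w x) i = h x i) \<or> (\<exists>i<m. h (w x) i \<noteq> h x i)" for w
    proof (cases "\<forall>i. h (w x) i = h x i")
      case False
      then obtain i where "h (w x) i \<noteq> h x i" by blast
      then show ?thesis by (intro eventually_sequentiallyI[of "Suc i"]) auto
    qed simp
    then have "\<forall>\<^sub>F m in sequentially. P m x"
      unfolding P_def by (intro eventually_ball_finite) simp_all
    then have "\<exists>m. P m x" by (rule eventually_happens'[OF sequentially_bot])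
    then show ?thesis unfolding m_def by (rule LeastI_ex)
  qed
  have hx: "(\<lambda>x. h x i) \<in> measurable M (count_space UNIV)" for i
    by (rule measurable_seq_apply[OF h(1)])
  have hw: "(\<lambda>x. h (w x) i) \<in> measurable M (count_space UNIV)" if "w \<in> set ws" for w i
    using measurable_compose[OF subsetD[OF ws that] hx] .
  have m: "m \<in> measurable M (count_space UNIV)"
    unfolding m_def
  proof (rule measurable_Least)
    fix k
    have "Measurable.pred M (\<lambda>x. h (w x) i = h x i)" if "w \<in> set ws" for w i
      using hw[OF that, of i] hx[of i] by measurable
    then show "Measurable.pred M (P k)"
      unfolding P_def by (intro pred_intros_finite pred_intros_logic pred_intros_countable) simp_all
  qed
  define c where "c x = to_nat (map (h x) [0..<m x])" for x
  have "(\<lambda>x. to_nat (map (\<lambda>i. h x i) [0..<k])) \<in> measurable M (count_space UNIV)" for k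
    by (rule measurable_compose[OF measurable_map_list]) (simp_all add: hx)
  then have "c \<in> measurable M (count_space UNIV)"
    unfolding c_def
    by (rule measurable_compose_countable[where f = "\<lambda>k x. to_nat (map (\<lambda>i. h x i) [0..<k])", OF _ m])
  moreover have "c (w x) \<noteq> c x" if x: "x \<in> space M" and w: "w \<in> set ws" and ne: "w x \<noteq> x" for x w
  proof
    assume "c (w x) = c x"
    then have eq: "map (h (w x)) [0..<m (w x)] = map (h x) [0..<m x]" by (simp add: c_def)
    then have len: "m (w x) = m x" by (metis length_map length_upt diff_zero)
    have "w x \<in> space M" using measurable_space[OF subsetD[OF ws w] x] .
    then have "h (w x) \<noteq> h x" using inj_onD[OF h(2)] x ne by blast
    then obtain i where "i < m x" "h (w x) i \<noteq> h x i"
      using P_m[of x] w unfolding P_def by (auto simp: fun_eq_iff)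
    moreover have "\<forall>j\<in>{0..<m x}. h (w x) j = h x j" using eq len by simp
    ultimately show False by simp
  qed
  ultimately show ?thesis by blast
qed

text \<open>Greedy recolouring along a proper colouring \<open>c\<close>: in step \<open>k\<close> all vertices of old colour \<open>k\<close> simultaneously
  receive the least positive colour not used so far in their neighbourhood. The value 0 means that
  a vertex has not been treated yet.\<close>

primrec greedy :: "('a \<Rightarrow> 'a) list \<Rightarrow> ('a \<Rightarrow> nat) \<Rightarrow> nat \<Rightarrow> 'a \<Rightarrow> nat" where
  "greedy ws c 0 x = 0"
| "greedy ws c (Suc k) x = (if c x = k then LEAST j. 0 < j \<and> (\<forall>w\<in>set ws. greedy ws c k (w x) \<noteq> j)
     else greedy ws c k x)"

lemma measurable_greedy:
  assumes ws: "set ws \<subseteq> measurable M M" and c: "c \<in> measurable M (count_space UNIV)"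
  shows "greedy ws c k \<in> measurable M (count_space UNIV)"
proof (induction k)
  case (Suc k)
  have "Measurable.pred M (\<lambda>x. 0 < j \<and> (\<forall>w\<in>set ws. greedy ws c k (w x) \<noteq> j))" for j
  proof -
    have "Measurable.pred M (\<lambda>x. greedy ws c k (w x) = j)" if "w \<in> set ws" for w
      using measurable_compose[OF subsetD[OF ws that] Suc] by measurable
    then show ?thesis by (intro pred_intros_finite pred_intros_logic) simp_all
  qed
  then have least: "(\<lambda>x. LEAST j. 0 < j \<and> (\<forall>w\<in>set ws. greedy ws c k (w x) \<noteq> j))
      \<in> measurable M (count_space UNIV)"
    by (rule measurable_Least)
  have "Measurable.pred M (\<lambda>x. c x = k)" using c by measurable
  then have "{x \<in> space M. c x = k} \<in> sets M" by (simp only: pred_def)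
  note measurable_If[OF least Suc this]
  moreover have "greedy ws c (Suc k) = (\<lambda>x. if c x = k
      then LEAST j. 0 < j \<and> (\<forall>w\<in>set ws. greedy ws c k (w x) \<noteq> j) else greedy ws c k x)"
    by (rule ext) (rule greedy.simps(2))
  ultimately show ?case by (simp only:)
next
  case 0
  have "greedy ws c 0 = (\<lambda>_. 0)" by (simp add: fun_eq_iff)
  then show ?case by simp
qed

lemma greedy_uncolored: "k \<le> c x \<Longrightarrow> greedy ws c k x = 0"
  by (induction k) auto

lemma greedy_stable: "c x < k \<Longrightarrow> greedy ws c k x = greedy ws c (Suc (c x)) x"
proof (induction k)
  case (Suc k)
  then show ?case by (cases "c x = k") auto
qed simp

text \<open>When a vertex is treated, it is itself still uncoloured, so at most \<open>n - 1\<close> positive colours are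
  forbidden and the least free one is at most \<open>n\<close>. Neighbours have different old colours, hence are treated
  at different times, and the later one avoids the colour of the earlier one.\<close>

lemma bounded_proper_coloring:
  fixes N :: "'a \<Rightarrow> 'a set"
  assumes sb: "standard_borel M" and ws: "set ws \<subseteq> measurable M M"
    and N: "\<And>x. x \<in> space M \<Longrightarrow> N x = (\<lambda>w. w x) ` set ws"
    and sym: "\<And>x y. x \<in> space M \<Longrightarrow> y \<in> N x \<Longrightarrow> x \<in> N y"
    and self: "\<And>x. x \<in> space M \<Longrightarrow> x \<in> N x"
    and card: "\<And>x. x \<in> space M \<Longrightarrow> card (N x) \<le> n"
  shows "\<exists>c :: 'a \<Rightarrow> nat. c \<in> measurable M (count_space UNIV) \<and> c ` space M \<subseteq> {1..n} \<and>
    (\<forall>x\<in>space M. \<forall>y\<in>N x. y \<noteq> x \<longrightarrow> c y \<noteq> c x)"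
proof -
  obtain c0 :: "'a \<Rightarrow> nat" where c0: "c0 \<in> measurable M (count_space UNIV)"
      "\<And>x w. x \<in> space M \<Longrightarrow> w \<in> set ws \<Longrightarrow> w x \<noteq> x \<Longrightarrow> c0 (w x) \<noteq> c0 x"
    using countable_proper_coloring[OF sb ws] by blast
  let ?g = "greedy ws c0"
  define c where "c x = ?g (Suc (c0 x)) x" for x
  have c_least: "c x = (LEAST j. 0 < j \<and> j \<notin> ?g (c0 x) ` N x)" if "x \<in> space M" for x
  proof -
    have "(\<forall>w\<in>set ws. ?g (c0 x) (w x) \<noteq> j) \<longleftrightarrow> j \<notin> ?g (c0 x) ` N x" for j
      using N[OF that] by auto
    then show ?thesis by (simp add: c_def)
  qed
  have ex: "\<exists>j\<in>{1..n}. j \<notin> ?g (c0 x) ` N x" if x: "x \<in> space M" for x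
  proof (rule ccontr)
    assume "\<not> ?thesis"
    then have sub: "{1..n} \<subseteq> ?g (c0 x) ` N x" by blast
    have fin: "finite (N x)" using N[OF x] by simp
    have "{1..n} \<subseteq> ?g (c0 x) ` (N x - {x})"
    proof
      fix j assume j: "j \<in> {1..n}"
      then obtain y where "y \<in> N x" "j = ?g (c0 x) y" using sub by blast
      moreover from this have "y \<noteq> x" using greedy_uncolored[of "c0 x" c0 x ws] j by auto
      ultimately show "j \<in> ?g (c0 x) ` (N x - {x})" by blast
    qed
    then have "card {1..n} \<le> card (N x - {x})"
      using fin by (meson card_image_le card_mono finite_Diff finite_imageI le_trans)
    also have "\<dots> < card (N x)" by (rule card_Diff1_less[OF fin self[OF x]])
    finally show False using card[OF x] by simp
  qed
  have c_new: "0 < c x \<and> c x \<notin> ?g (c0 x) ` N x" "c x \<le> n" if x: "x \<in> space M" for x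
  proof -
    obtain j where j: "j \<in> {1..n}" "j \<notin> ?g (c0 x) ` N x" using ex[OF x] by blast
    then have pos: "0 < j \<and> j \<notin> ?g (c0 x) ` N x" by simp
    show "0 < c x \<and> c x \<notin> ?g (c0 x) ` N x"
      unfolding c_least[OF x] by (rule LeastI[where P = "\<lambda>j. 0 < j \<and> j \<notin> ?g (c0 x) ` N x", OF pos])
    have "c x \<le> j"
      unfolding c_least[OF x] by (rule Least_le[where P = "\<lambda>j. 0 < j \<and> j \<notin> ?g (c0 x) ` N x", OF pos])
    then show "c x \<le> n" using j(1) by simp
  qed
  have "c ` space M \<subseteq> {1..n}"
  proof (rule image_subsetI)
    show "c x \<in> {1..n}" if "x \<in> space M" for x
      using c_new[OF that] by (simp add: Suc_le_eq)
  qed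
  moreover have "c \<in> measurable M (count_space UNIV)"
  proof -
    have "(\<lambda>x. ?g (Suc (c0 x)) x) \<in> measurable M (count_space UNIV)"
      by (rule measurable_compose_countable[where f = "\<lambda>k x. ?g (Suc k) x" and g = c0,
            OF measurable_greedy[OF ws c0(1)] c0(1)])
    then show ?thesis by (simp only: c_def[abs_def])
  qed
  moreover have "c y \<noteq> c x" if x: "x \<in> space M" and y: "y \<in> N x" and ne: "y \<noteq> x" for x y
  proof -
    have sep: "c u \<noteq> c v" if "u \<in> space M" "v \<in> N u" "c0 v < c0 u" for u v
    proof -
      have "?g (c0 u) v = c v" unfolding c_def by (rule greedy_stable) (rule that(3))
      then show ?thesis using c_new(1)[OF that(1)] that(2) by (metis imageI)
    qed
    obtain w where w: "w \<in> set ws" "y = w x" using N[OF x] y by blast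
    have "y \<in> space M" using measurable_space[OF subsetD[OF ws w(1)] x] w(2) by simp
    moreover have "c0 y \<noteq> c0 x" using c0(2)[OF x w(1)] w(2) ne by simp
    ultimately show ?thesis
      using sep[OF x y] sep[of y x] sym[OF x y] by (cases "c0 y < c0 x") auto
  qed
  ultimately show ?thesis by blast
qed

section \<open>Borel measurability of LOCAL algorithms\<close>

text \<open>Borelness of the structure map, expressed along tuples of Borel functions. This form is stable under
  adding a Borel labelling and matches the enumeration of balls by functions.\<close>

definition borel_structure :: "'a measure \<Rightarrow> 'a sgraph \<Rightarrow> bool" where
  "borel_structure M G \<longleftrightarrow> (\<forall>ws. set ws \<subseteq> measurable M M \<longrightarrow>
     (\<lambda>x. str_map G (map (\<lambda>w. w x) ws)) \<in> measurable M (count_space UNIV))"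

lemma borel_structureD:
  assumes "borel_structure M G" "set ws \<subseteq> measurable M M"
  shows "(\<lambda>x. str_map G (map (\<lambda>w. w x) ws)) \<in> measurable M (count_space UNIV)"
  using assms unfolding borel_structure_def by blast

lemma measurable_option:
  fixes f :: "'a \<Rightarrow> 'b::countable option"
  assumes "\<And>c. {x \<in> space M. f x = Some c} \<in> sets M"
  shows "f \<in> measurable M (count_space UNIV)"
proof (rule measurableI)
  fix A :: "'b option set"
  have "f -` A \<inter> space M = (\<Union>c. if Some c \<in> A then {x \<in> space M. f x = Some c} else {}) \<union>
      (if None \<in> A then space M - (\<Union>c. {x \<in> space M. f x = Some c}) else {})"
  proof (rule set_eqI)
    fix x
    show "x \<in> f -` A \<inter> space M \<longleftrightarrow>
      x \<in> (\<Union>c. if Some c \<in> A then {x \<in> space M. f x = Some c} else {}) \<union>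
      (if None \<in> A then space M - (\<Union>c. {x \<in> space M. f x = Some c}) else {})"
      by (cases "f x") (auto split: if_splits)
  qed
  also have "\<dots> \<in> sets M"
    using assms by (intro sets.Un sets.countable_UN'') (auto intro!: sets.Diff sets.countable_UN'')
  finally show "f -` A \<inter> space M \<in> sets M" .
qed simp

lemma borel_structure_of_borel:
  assumes "borel_structured_graph M G"
  shows "borel_structure M G"
  unfolding borel_structure_def
proof (intro allI impI measurable_option)
  fix ws c assume ws: "set ws \<subseteq> measurable M M"
  let ?k = "length ws" and ?A = "{xs. str_map G xs = Some c}"
  let ?f = "\<lambda>x. \<lambda>i\<in>{..<length ws}. (ws ! i) x"
  have f: "?f \<in> measurable M (Pi\<^sub>M {..<?k} (\<lambda>_. M))"
    using ws by (intro measurable_restrict) (auto simp: subset_eq)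
  have "?A \<in> borel_tuples M" using assms by (simp add: borel_structured_graph_def)
  then have "{v \<in> space (Pi\<^sub>M {..<?k} (\<lambda>_. M)). map v [0..<?k] \<in> ?A} \<in> sets (Pi\<^sub>M {..<?k} (\<lambda>_. M))"
    unfolding borel_tuples_def by blast
  from measurable_sets[OF f this]
  have "?f -` {v \<in> space (Pi\<^sub>M {..<?k} (\<lambda>_. M)). map v [0..<?k] \<in> ?A} \<inter> space M \<in> sets M" .
  also have "?f -` {v \<in> space (Pi\<^sub>M {..<?k} (\<lambda>_. M)). map v [0..<?k] \<in> ?A} \<inter> space M =
      {x \<in> space M. str_map G (map (\<lambda>w. w x) ws) = Some c}"
  proof -
    have "map (?f x) [0..<?k] = map (\<lambda>w. w x) ws" for x
      by (rule nth_equalityI) simp_all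
    then show ?thesis using measurable_space[OF f] by auto
  qed
  finally show "{x \<in> space M. str_map G (map (\<lambda>w. w x) ws) = Some c} \<in> sets M" .
qed

text \<open>Adding a labelling changes the structure map at singletons by the values of \<open>f\<close>, and elsewhere only by
  recoding.\<close>

lemma borel_structure_add_fun:
  assumes G: "borel_structure M G" and V: "verts G = space M"
    and f: "f \<in> measurable M (count_space UNIV)"
  shows "borel_structure M (add_fun G f)"
  unfolding borel_structure_def
proof (intro allI impI)
  fix ws assume ws: "set ws \<subseteq> measurable M M"
  note \<sigma> = borel_structureD[OF G ws]
  show "(\<lambda>x. str_map (add_fun G f) (map (\<lambda>w. w x) ws)) \<in> measurable M (count_space UNIV)"
  proof (cases "\<exists>w. ws = [w]")
    case True
    then obtain w where w: "ws = [w]" by blast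
    have wm: "w \<in> measurable M M" using ws w by simp
    have "str_map (add_fun G f) (map (\<lambda>w. w x) ws) =
        Some (to_nat (str_map G (map (\<lambda>w. w x) ws), Some (f (w x))))" if "x \<in> space M" for x
      using measurable_space[OF wm that] V by (auto simp: str_map_add_fun on_singletons_restrict w)
    moreover have "(\<lambda>x. Some (to_nat (str_map G (map (\<lambda>w. w x) ws), Some (f (w x)))))
        \<in> measurable M (count_space UNIV)"
    proof (rule measurable_compose_countable[where g = "\<lambda>x. f (w x)"])
      show "(\<lambda>x. Some (to_nat (str_map G (map (\<lambda>w. w x) ws), Some j)))
          \<in> measurable M (count_space UNIV)" for j
        by (rule measurable_compose[OF \<sigma>]) simp
      show "(\<lambda>x. f (w x)) \<in> measurable M (count_space UNIV)"
        by (rule measurable_compose[OF wm f])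
    qed
    ultimately show ?thesis by (simp cong: measurable_cong)
  next
    case False
    then have ne: "map (\<lambda>w. w x) ws \<noteq> [y]" for x y by (auto simp: map_eq_Cons_conv)
    have no: "map (\<lambda>w. w x) ws \<notin> (\<lambda>x. [x]) ` verts G"
        "\<not> (\<exists>y\<in>verts G. map (\<lambda>w. w x) ws = [y])" for x
      using ne[of x] by (simp_all only: image_iff simp_thms bex_simps ball_triv)
    have "str_map (add_fun G f) (map (\<lambda>w. w x) ws) =
        map_option (\<lambda>v. to_nat (Some v, None :: nat option)) (str_map G (map (\<lambda>w. w x) ws))" for x
      by (cases "str_map G (map (\<lambda>w. w x) ws)")
        (simp_all only: str_map_add_fun on_singletons_restrict Un_iff no domIff option.simps
          simp_thms if_True if_False)
    then show ?thesis using measurable_compose[OF \<sigma>, of "map_option _" "count_space UNIV"] by simp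
  qed
qed

text \<open>Enumerate the ball of radius \<open>r\<close> around \<open>x\<close> as \<open>w x\<close> for \<open>w\<close> in a finite set \<open>W\<close> of Borel functions. If two points \<open>x\<close>
  and \<open>x'\<close> agree about which \<open>w\<close> coincide, which pairs are adjacent and what the structure map does on
  tuples of bounded length, then \<open>w x \<mapsto> w x'\<close> is an isomorphism of the balls. These are finitely many Borel
  conditions, so \<open>measurable_finitely_determined\<close> applies.\<close>

lemma measurable_local_output:
  assumes sb: "standard_borel M" and G: "structured_graph G" "verts G = space M"
    and E: "edges G \<in> sets (M \<Otimes>\<^sub>M M)" and \<sigma>: "borel_structure M G"
    and ws0: "set ws0 \<subseteq> measurable M M"
    and nbhd0: "\<And>x. x \<in> space M \<Longrightarrow> nbhd G x r = (\<lambda>w. w x) ` set ws0"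
  shows "local_output A G r \<in> measurable M (count_space UNIV)"
proof -
  have lf: "lf_graph G" using G(1) by (simp add: structured_graph_def)
  define W where "W = insert (\<lambda>x. x) (set ws0)"
  have W: "W \<subseteq> measurable M M" "finite W" "(\<lambda>x. x) \<in> W" using ws0 by (auto simp: W_def)
  have nbhd: "nbhd G x r = (\<lambda>w. w x) ` W" if "x \<in> space M" for x
    using nbhd0[OF that] nbhd_refl[of x G r] by (auto simp: W_def)
  have W_space: "w x \<in> space M" if "w \<in> W" "x \<in> space M" for w x
    using measurable_space[OF subsetD[OF W(1) that(1)] that(2)] .
  obtain l where l: "\<And>xs. xs \<in> dom (str_map G) \<Longrightarrow> length xs \<le> l"
    using G(1) unfolding structured_graph_def by blast
  obtain h where h: "h \<in> measurable M (seq_space :: (nat \<Rightarrow> nat) measure)" "inj_on h (space M)"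
    using standard_borel_separating_map[OF sb] by blast
  define L where "L = {ws. set ws \<subseteq> W \<and> length ws \<le> l}"
  \<comment> \<open>the keys: coincidences, adjacencies and values of the structure map\<close>
  define K1 :: "('a \<Rightarrow> nat) set" where "K1 = (\<lambda>(w, w') x. of_bool (w x = w' x)) ` (W \<times> W)"
  define K2 :: "('a \<Rightarrow> nat) set"
    where "K2 = (\<lambda>(w, w') x. of_bool ((w x, w' x) \<in> edges G)) ` (W \<times> W)"
  define K3 :: "('a \<Rightarrow> nat) set" where "K3 = (\<lambda>ws x. to_nat (str_map G (map (\<lambda>w. w x) ws))) ` L"
  have of_bool: "(\<lambda>x. of_bool (Q x) :: nat) \<in> measurable M (count_space UNIV)"
    if "{x \<in> space M. Q x} \<in> sets M" for Q
  proof -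
    have "Measurable.pred M Q" using that by (simp add: pred_def)
    from measurable_compose[OF this, of of_bool "count_space UNIV"] show ?thesis by simp
  qed
  show ?thesis
  proof (rule measurable_finitely_determined)
    show "finite (K1 \<union> K2 \<union> K3)"
      unfolding K1_def K2_def K3_def L_def using W(2) by (simp add: finite_lists_length_le)
    show "K1 \<union> K2 \<union> K3 \<subseteq> measurable M (count_space UNIV)"
    proof (intro Un_least subsetI)
      fix k assume "k \<in> K1"
      then obtain w w' where k: "w \<in> W" "w' \<in> W" "k = (\<lambda>x. of_bool (w x = w' x))"
        by (auto simp: K1_def)
      have eq: "{x \<in> space M. w x = w' x} = {x \<in> space M. \<forall>i. h (w x) i = h (w' x) i}"
        using inj_on_eq_iff[OF h(2)] W_space k(1,2) by (auto simp: fun_eq_iff[symmetric])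
      have "Measurable.pred M (\<lambda>x. h (w x) i = h (w' x) i)" for i
      proof -
        have "(\<lambda>x. h (w x) i) \<in> measurable M (count_space UNIV)" if "w \<in> W" for w
          using measurable_compose[OF subsetD[OF W(1) that] measurable_seq_apply[OF h(1)]] .
        from this[OF k(1)] this[OF k(2)] show ?thesis by measurable
      qed
      then have "Measurable.pred M (\<lambda>x. \<forall>i. h (w x) i = h (w' x) i)" by (rule pred_intros_countable)
      then show "k \<in> measurable M (count_space UNIV)"
        unfolding k(3) by (intro of_bool) (simp add: eq pred_def)
    next
      fix k assume "k \<in> K2"
      then obtain w w' where k: "w \<in> W" "w' \<in> W" "k = (\<lambda>x. of_bool ((w x, w' x) \<in> edges G))"
        by (auto simp: K2_def)
      show "k \<in> measurable M (count_space UNIV)"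
        unfolding k(3) using W(1) k(1,2) by (intro of_bool measurable_pair_preimage[OF _ _ E]) auto
    next
      fix k assume "k \<in> K3"
      then obtain ws where ws: "set ws \<subseteq> W" "k = (\<lambda>x. to_nat (str_map G (map (\<lambda>w. w x) ws)))"
        by (auto simp: K3_def L_def)
      have "set ws \<subseteq> measurable M M" using ws(1) W(1) by simp
      from measurable_compose[OF borel_structureD[OF \<sigma> this], of to_nat "count_space UNIV"]
      show "k \<in> measurable M (count_space UNIV)" unfolding ws(2) by simp
    qed
  next
    fix x x' assume x: "x \<in> space M" "x' \<in> space M"
      and same: "\<And>k. k \<in> K1 \<union> K2 \<union> K3 \<Longrightarrow> k x = k x'"
    \<comment> \<open>equality of the three kinds of keys, read off for each choice of functions\<close>
    have eq: "w x = w' x \<longleftrightarrow> w x' = w' x'" if "w \<in> W" "w' \<in> W" for w w'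
    proof -
      have "(\<lambda>x. of_bool (w x = w' x)) \<in> K1" using that unfolding K1_def by force
      from same[OF UnI1[OF UnI1[OF this]]] show ?thesis by (simp add: of_bool_eq_iff)
    qed
    have edge: "(w x, w' x) \<in> edges G \<longleftrightarrow> (w x', w' x') \<in> edges G" if "w \<in> W" "w' \<in> W" for w w'
    proof -
      have "(\<lambda>x. of_bool ((w x, w' x) \<in> edges G)) \<in> K2" using that unfolding K2_def by force
      from same[OF UnI1[OF UnI2[OF this]]] show ?thesis by (simp add: of_bool_eq_iff)
    qed
    have str: "str_map G (map (\<lambda>w. w x) ws) = str_map G (map (\<lambda>w. w x') ws)" if "set ws \<subseteq> W" for ws
    proof (cases "length ws \<le> l")
      case True
      then have "(\<lambda>x. to_nat (str_map G (map (\<lambda>w. w x) ws))) \<in> K3"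
        using that unfolding K3_def L_def by blast
      from same[OF UnI2[OF this]] show ?thesis by simp
    next
      case False
      then have "map (\<lambda>w. w y) ws \<notin> dom (str_map G)" for y using l[of "map (\<lambda>w. w y) ws"] by auto
      then show ?thesis by (simp add: domIff)
    qed
    \<comment> \<open>the choice of \<open>w\<close> does not matter, because coincidences at \<open>x\<close> and \<open>x'\<close> agree\<close>
    define \<phi> where "\<phi> v = (SOME w. w \<in> W \<and> w x = v) x'" for v
    have \<phi>: "\<phi> (w x) = w x'" if "w \<in> W" for w
    proof -
      have "(SOME w'. w' \<in> W \<and> w' x = w x) \<in> W \<and> (SOME w'. w' \<in> W \<and> w' x = w x) x = w x"
        by (rule someI[of "\<lambda>w'. w' \<in> W \<and> w' x = w x"]) (use that in simp)
      then show ?thesis unfolding \<phi>_def using eq that by blast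
    qed
    have map\<phi>: "map \<phi> (map (\<lambda>w. w x) ws) = map (\<lambda>w. w x') ws" if "set ws \<subseteq> W" for ws
      using that \<phi> by auto
    have ball: "verts (sball G y r) = (\<lambda>w. w y) ` W"
        "edges (sball G y r) = edges G \<inter> (\<lambda>w. w y) ` W \<times> (\<lambda>w. w y) ` W"
        "str_map (sball G y r) = str_map G |` (map (\<lambda>w. w y) ` lists W)" if "y \<in> space M" for y
    proof -
      have "sball G y r = induced G ((\<lambda>w. w y) ` W)"
        using sball_eq_induced[OF lf, of y r] that G(2) nbhd by simp
      moreover have "verts (sball G y r) = (\<lambda>w. w y) ` W"
        using verts_sball[OF lf, of y r] that G(2) nbhd by simp
      ultimately show "verts (sball G y r) = (\<lambda>w. w y) ` W"
        "edges (sball G y r) = edges G \<inter> (\<lambda>w. w y) ` W \<times> (\<lambda>w. w y) ` W"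
        "str_map (sball G y r) = str_map G |` (map (\<lambda>w. w y) ` lists W)"
        by (simp_all add: induced_def lists_image)
    qed
    have "sgraph_iso \<phi> (sball G x r) (sball G x' r)"
      unfolding sgraph_iso_def
    proof (intro conjI ballI)
      show "bij_betw \<phi> (verts (sball G x r)) (verts (sball G x' r))"
        unfolding ball[OF x(1)] ball[OF x(2)]
      proof (rule bij_betw_imageI)
        show "inj_on \<phi> ((\<lambda>w. w x) ` W)" using \<phi> eq by (auto simp: inj_on_def)
        show "\<phi> ` (\<lambda>w. w x) ` W = (\<lambda>w. w x') ` W" using \<phi> by (simp add: image_image)
      qed
      show "(u, v) \<in> edges (sball G x r) \<longleftrightarrow> (\<phi> u, \<phi> v) \<in> edges (sball G x' r)"
        if uv: "u \<in> verts (sball G x r)" "v \<in> verts (sball G x r)" for u v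
      proof -
        obtain w w' where "w \<in> W" "w' \<in> W" "u = w x" "v = w' x"
          using uv unfolding ball[OF x(1)] by blast
        then show ?thesis
          unfolding ball[OF x(1)] ball[OF x(2)] using edge \<phi> by simp
      qed
      show "dom (str_map (sball G x' r)) = map \<phi> ` dom (str_map (sball G x r))"
      proof (intro equalityI subsetI)
        fix ys assume "ys \<in> dom (str_map (sball G x' r))"
        then obtain ws where ws: "ws \<in> lists W" "ys = map (\<lambda>w. w x') ws" "ys \<in> dom (str_map G)"
          unfolding ball[OF x(2)] by auto
        have sub: "set ws \<subseteq> W" using ws(1) by auto
        have "map (\<lambda>w. w x) ws \<in> dom (str_map (sball G x r))"
          using ws str[OF sub] unfolding ball[OF x(1)] by (auto simp: domIff)
        moreover have "ys = map \<phi> (map (\<lambda>w. w x) ws)" using map\<phi>[OF sub] ws(2) by simp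
        ultimately show "ys \<in> map \<phi> ` dom (str_map (sball G x r))" by (rule rev_image_eqI)
      next
        fix ys assume "ys \<in> map \<phi> ` dom (str_map (sball G x r))"
        then obtain xs where xs: "ys = map \<phi> xs" "xs \<in> dom (str_map (sball G x r))" by blast
        then have "xs \<in> map (\<lambda>w. w x) ` lists W" "xs \<in> dom (str_map G)"
          unfolding ball[OF x(1)] by auto
        then obtain ws where ws: "ws \<in> lists W" "ys = map \<phi> (map (\<lambda>w. w x) ws)"
            "map (\<lambda>w. w x) ws \<in> dom (str_map G)"
          using xs(1) by blast
        have sub: "set ws \<subseteq> W" using ws(1) by auto
        have ys: "ys = map (\<lambda>w. w x') ws" using ws(2) map\<phi>[OF sub] by (simp only:)
        have "ys \<in> dom (str_map G)" using ws(3) str[OF sub] unfolding ys domIff by simp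
        moreover have "ys \<in> map (\<lambda>w. w x') ` lists W" unfolding ys using ws(1) by (rule imageI)
        ultimately show "ys \<in> dom (str_map (sball G x' r))"
          unfolding ball[OF x(2)] dom_restrict by (rule IntI)
      qed
      show "str_map (sball G x r) xs = str_map (sball G x' r) (map \<phi> xs)"
        if xs: "xs \<in> dom (str_map (sball G x r))" for xs
      proof -
        obtain ws where ws: "ws \<in> lists W" "xs = map (\<lambda>w. w x) ws"
          using xs unfolding ball[OF x(1)] by auto
        have sub: "set ws \<subseteq> W" using ws(1) by auto
        then show ?thesis
          using ws str[OF sub] map\<phi>[OF sub] unfolding ball[OF x(1)] ball[OF x(2)]
          by (simp add: restrict_map_def del: map_map)
      qed
    qed
    moreover have "\<phi> x = x'" using \<phi>[OF W(3)] by simp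
    ultimately show "local_output A G r x = local_output A G r x'"
      using x G(2) by (intro local_output_eqI[where \<phi> = \<phi>] G(1)) simp_all
  qed
qed

lemma Det_attained:
  assumes "Det \<pi> \<G> n < \<infinity>"
  shows "Det_le \<pi> \<G> n (the_enat (Det \<pi> \<G> n))"
proof -
  let ?S = "{T. Det_le \<pi> \<G> n T}"
  have ne: "enat ` ?S \<noteq> {}"
  proof
    assume "enat ` ?S = {}"
    then have "Det \<pi> \<G> n = \<infinity>" by (simp only: Det_def Inf_empty top_enat_def)
    then show False using assms by simp
  qed
  then obtain T where "T \<in> ?S" by blast
  have "Inf (enat ` ?S) \<in> enat ` ?S"
    unfolding Inf_enat_def using ne \<open>T \<in> ?S\<close>
    by (auto intro!: LeastI[where P = "\<lambda>z. z \<in> enat ` ?S", of "enat T"])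
  then show ?thesis unfolding Det_def by auto
qed

section \<open>Borel colourings from deterministic LOCAL algorithms\<close>

theorem theorem2p10:
  fixes t n R :: nat and P :: local_algorithm and \<G> :: "sgraph_class set"
    and M :: "'a measure" and G :: "'a sgraph"
  assumes "local_coloring_problem (t, P)"
    and "\<G> \<subseteq> FSG"
    and "n > 0"
    and "Det (t, P) \<G> n < \<infinity>"
    and "R = the_enat (Det (t, P) \<G> n) + t"
    and "borel_structured_graph M G"
    and "locally_in G R n \<G>"
    and "\<forall>x\<in>verts G. card (verts (sball G x (2 * R))) \<le> n"
  shows "\<exists>f. borel_coloring M (t, P) G f"
proof -
  define T where "T = the_enat (Det (t, P) \<G> n)"
  have R: "R = T + t" using assms(5) by (simp add: T_def)
  have G: "structured_graph G" "borel_graph M G" using assms(6) by (auto simp: borel_structured_graph_def)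
  then have lf: "lf_graph G" and V: "verts G = space M" and sb: "standard_borel M"
    and E: "edges G \<in> sets (M \<Otimes>\<^sub>M M)"
    by (auto simp: borel_graph_def)
  have card: "card (nbhd G x (2 * R)) \<le> n" if "x \<in> space M" for x
    using assms(8) that V verts_sball[OF lf] by auto
  \<comment> \<open>for \<open>R = 0\<close> the hypothesis on balls does not bound the degree, but then only balls of radius 0 matter\<close>
  have enum: "\<exists>ws. set ws \<subseteq> measurable M M \<and> (\<forall>x\<in>space M. nbhd G x r = (\<lambda>w. w x) ` set ws)"
    if r: "r \<le> 2 * R" for r
  proof (cases "R = 0")
    case True
    then show ?thesis using r by (intro exI[of _ "[\<lambda>x. x]"]) (simp add: nbhd_0)
  next
    case False
    have "card (edges G `` {x}) \<le> n" if x: "x \<in> verts G" for x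
    proof -
      have "edges G `` {x} \<subseteq> nbhd G x (Suc 0)" by (auto simp: nbhd_Suc nbhd_0)
      also have "\<dots> \<subseteq> nbhd G x (2 * R)" using False by (intro nbhd_mono) simp
      finally have "card (edges G `` {x}) \<le> card (nbhd G x (2 * R))"
        by (rule card_mono[OF finite_nbhd[OF lf x]])
      also have "\<dots> \<le> n" using card x V by simp
      finally show ?thesis .
    qed
    then show ?thesis by (rule nbhd_enumeration[OF G(2)])
  qed
  obtain ws where ws: "set ws \<subseteq> measurable M M"
      "\<And>x. x \<in> space M \<Longrightarrow> nbhd G x (2 * R) = (\<lambda>w. w x) ` set ws"
    using enum[of "2 * R"] by blast
  have "sym (edges G)" using lf by (simp add: lf_graph_def)
  have "\<exists>c :: 'a \<Rightarrow> nat. c \<in> measurable M (count_space UNIV) \<and> c ` space M \<subseteq> {1..n} \<and>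
      (\<forall>x\<in>space M. \<forall>y\<in>nbhd G x (2 * R). y \<noteq> x \<longrightarrow> c y \<noteq> c x)"
  proof (intro bounded_proper_coloring[OF sb ws(1)])
    fix x y assume x: "x \<in> space M"
    show "nbhd G x (2 * R) = (\<lambda>w. w x) ` set ws" using x by (rule ws(2))
    show "x \<in> nbhd G x (2 * R)" by (rule nbhd_refl)
    show "card (nbhd G x (2 * R)) \<le> n" using x by (rule card)
    show "x \<in> nbhd G y (2 * R)" if "y \<in> nbhd G x (2 * R)"
      using \<open>sym (edges G)\<close> that by (rule nbhd_sym)
  qed
  then obtain c :: "'a \<Rightarrow> nat" where c: "c \<in> measurable M (count_space UNIV)"
      "c ` space M \<subseteq> {1..n}"
      "\<forall>x\<in>space M. \<forall>y\<in>nbhd G x (2 * R). y \<noteq> x \<longrightarrow> c y \<noteq> c x"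
    by (elim exE conjE)
  obtain A where A: "\<forall>(H :: nat sgraph) ids. structured_graph H \<and> finite (verts H) \<and>
      card (verts H) = n \<and> iso_class H \<in> \<G> \<and> bij_betw ids (verts H) {1..n} \<longrightarrow>
      is_coloring (t, P) H (local_output A (add_fun H ids) T)"
    using Det_attained[OF assms(4)] unfolding Det_le_def T_def[symmetric] by (rule exE)
  have "is_coloring (t, P) G (local_output A (add_fun G c) T)"
  proof (rule local_algorithm_on_proper_coloring[OF G(1) assms(7)[unfolded R]])
    show "is_coloring (t, P) H (local_output A (add_fun H ids) T)"
      if "structured_graph H" "finite (verts H)" "card (verts H) = n" "iso_class H \<in> \<G>"
        "bij_betw ids (verts H) {1..n}" for H :: "nat sgraph" and ids
      using that by (intro A[rule_format] conjI)
    show "c ` verts G \<subseteq> {1..n}" using c(2) V by simp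
    show "c u \<noteq> c v" if "u \<in> verts G" "v \<in> nbhd G u (2 * (T + t))" "u \<noteq> v" for u v
      using c(3)[rule_format, of u v] that V R by metis
  qed
  moreover have "local_output A (add_fun G c) T \<in> measurable M (count_space UNIV)"
  proof -
    obtain ws' where ws': "set ws' \<subseteq> measurable M M"
        "\<And>x. x \<in> space M \<Longrightarrow> nbhd G x T = (\<lambda>w. w x) ` set ws'"
      using enum[of T] R by auto
    have str: "borel_structure M (add_fun G c)"
      by (rule borel_structure_add_fun[OF borel_structure_of_borel[OF assms(6)] V c(1)])
    show ?thesis
    proof (rule measurable_local_output[OF sb structured_add_fun[OF G(1)] _ _ str ws'(1)])
      show "nbhd (add_fun G c) x T = (\<lambda>w. w x) ` set ws'" if "x \<in> space M" for x
        using ws'(2)[OF that] by simp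
    qed (simp_all add: V E)
  qed
  ultimately show ?thesis unfolding borel_coloring_def by blast
qed

end
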